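(* Let $G$ be a near-triangulation that does not contain $K_4$ as an induced subgraph. Then $G$ is word-representable if and only if $G$ is internally even, i.e. every inner vertex of $G$ has even degree.
   Context: A near-triangulation is a (finite) planar graph, given with a plane embedding, in which every bounded face is a triangle; the outer face need not be a triangle. An inner vertex is a vertex not incident to the outer face. A graph $G=(V,E)$ is word-representable if there is a word $w$ over the alphabet $V$ such that for all distinct $x,y\in V$, the letters $x$ and $y$ alternate in $w$ if and only if $(x,y)\in E$. *)

theory Defs
  imports "HOL-Analysis.Analysis"
begin

definition simple_graph :: "'v set \<Rightarrow> ('v \<Rightarrow> 'v \<Rightarrow> bool) \<Rightarrow> bool" where
  "simple_graph V adj \<longleftrightarrow> finite V
     \<and> (\<forall>u v. adj u v \<longrightarrow> u \<in> V \<and> v \<in> V)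
     \<and> (\<forall>u v. adj u v \<longrightarrow> adj v u)
     \<and> (\<forall>v. \<not> adj v v)"

definition degree :: "'v set \<Rightarrow> ('v \<Rightarrow> 'v \<Rightarrow> bool) \<Rightarrow> 'v \<Rightarrow> nat" where
  "degree V adj v = card {u \<in> V. adj v u}"

definition alternate :: "'v list \<Rightarrow> 'v \<Rightarrow> 'v \<Rightarrow> bool" where
  "alternate w x y \<longleftrightarrow>
     (let u = filter (\<lambda>z. z = x \<or> z = y) w in
        \<forall>i. Suc i < length u \<longrightarrow> u ! i \<noteq> u ! Suc i)"

definition word_representable :: "'v set \<Rightarrow> ('v \<Rightarrow> 'v \<Rightarrow> bool) \<Rightarrow> bool" where
  "word_representable V adj \<longleftrightarrow>
     (\<exists>w. set w = V \<and>
        (\<forall>x\<in>V. \<forall>y\<in>V. x \<noteq> y \<longrightarrow> (alternate w x y \<longleftrightarrow> adj x y)))"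

definition contains_K4 :: "'v set \<Rightarrow> ('v \<Rightarrow> 'v \<Rightarrow> bool) \<Rightarrow> bool" where
  "contains_K4 V adj \<longleftrightarrow>
     (\<exists>a\<in>V. \<exists>b\<in>V. \<exists>c\<in>V. \<exists>d\<in>V. distinct [a,b,c,d]
        \<and> adj a b \<and> adj a c \<and> adj a d \<and> adj b c \<and> adj b d \<and> adj c d)"

definition plane_embedding ::
  "'v set \<Rightarrow> ('v \<Rightarrow> 'v \<Rightarrow> bool) \<Rightarrow> ('v \<Rightarrow> complex) \<Rightarrow> ('v \<Rightarrow> 'v \<Rightarrow> real \<Rightarrow> complex) \<Rightarrow> bool" where
  "plane_embedding V adj pos cv \<longleftrightarrow>
     inj_on pos V
     \<and> (\<forall>u v. adj u v \<longrightarrow> arc (cv u v) \<and> pathstart (cv u v) = pos u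
            \<and> pathfinish (cv u v) = pos v \<and> path_image (cv u v) = path_image (cv v u))
     \<and> (\<forall>u v w. adj u v \<and> w \<in> V \<and> pos w \<in> path_image (cv u v) \<longrightarrow> w = u \<or> w = v)
     \<and> (\<forall>u v x y. adj u v \<and> adj x y \<and> {u, v} \<noteq> {x, y} \<longrightarrow>
            path_image (cv u v) \<inter> path_image (cv x y) \<subseteq> pos ` ({u, v} \<inter> {x, y}))"

definition drawing ::
  "'v set \<Rightarrow> ('v \<Rightarrow> 'v \<Rightarrow> bool) \<Rightarrow> ('v \<Rightarrow> complex) \<Rightarrow> ('v \<Rightarrow> 'v \<Rightarrow> real \<Rightarrow> complex) \<Rightarrow> complex set" where
  "drawing V adj pos cv = pos ` V \<union> (\<Union>{path_image (cv u v) | u v. adj u v})"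

definition faces ::
  "'v set \<Rightarrow> ('v \<Rightarrow> 'v \<Rightarrow> bool) \<Rightarrow> ('v \<Rightarrow> complex) \<Rightarrow> ('v \<Rightarrow> 'v \<Rightarrow> real \<Rightarrow> complex) \<Rightarrow> complex set set" where
  "faces V adj pos cv =
     {connected_component_set (- drawing V adj pos cv) z | z. z \<notin> drawing V adj pos cv}"

definition near_triangulation ::
  "'v set \<Rightarrow> ('v \<Rightarrow> 'v \<Rightarrow> bool) \<Rightarrow> ('v \<Rightarrow> complex) \<Rightarrow> ('v \<Rightarrow> 'v \<Rightarrow> real \<Rightarrow> complex) \<Rightarrow> bool" where
  "near_triangulation V adj pos cv \<longleftrightarrow>
     simple_graph V adj \<and> plane_embedding V adj pos cv
     \<and> (\<forall>F \<in> faces V adj pos cv. bounded F \<longrightarrow>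
          (\<exists>a\<in>V. \<exists>b\<in>V. \<exists>c\<in>V. distinct [a, b, c] \<and> adj a b \<and> adj b c \<and> adj c a
             \<and> frontier F = path_image (cv a b) \<union> path_image (cv b c) \<union> path_image (cv c a)))"

definition inner_vertex ::
  "'v set \<Rightarrow> ('v \<Rightarrow> 'v \<Rightarrow> bool) \<Rightarrow> ('v \<Rightarrow> complex) \<Rightarrow> ('v \<Rightarrow> 'v \<Rightarrow> real \<Rightarrow> complex) \<Rightarrow> 'v \<Rightarrow> bool" where
  "inner_vertex V adj pos cv v \<longleftrightarrow> v \<in> V \<and>
     (\<forall>F \<in> faces V adj pos cv. \<not> bounded F \<longrightarrow> pos v \<notin> frontier F)"

definition internally_even ::
  "'v set \<Rightarrow> ('v \<Rightarrow> 'v \<Rightarrow> bool) \<Rightarrow> ('v \<Rightarrow> complex) \<Rightarrow> ('v \<Rightarrow> 'v \<Rightarrow> real \<Rightarrow> complex) \<Rightarrow> bool" where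
  "internally_even V adj pos cv \<longleftrightarrow>
     (\<forall>v. inner_vertex V adj pos cv v \<longrightarrow> even (degree V adj v))"

end

theory Submission
  imports Defs
begin

text \<open>
  If \<open>G\<close> is word-representable and \<open>v\<close> is a vertex, then two neighbours of \<open>v\<close> are adjacent iff their
  occurrence counts, taken relative to those of \<open>v\<close> and shifted into \<open>{0, 1}\<close>, are pointwise comparable
  along the word. So adjacency on \<open>N(v)\<close> is comparability in a partial order; without \<open>K\<^sub>4\<close> this order
  has no chain of length three, hence \<open>N(v)\<close> is bipartite. If \<open>v\<close> is inner, every edge at \<open>v\<close> lies on
  exactly two bounded faces, so the edges opposite to \<open>v\<close> in these triangles form a 2-regular graph
  on \<open>N(v)\<close>. Counting its edges from both colour classes shows that \<open>N(v)\<close> has even size.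

  Conversely, an internally even near-triangulation is 3-colourable, by induction on the edges. Delete
  an edge \<open>uv\<close> on the outer face and suppose that the colouring of the rest gives \<open>u\<close> and \<open>v\<close> the same
  colour. If \<open>uv\<close> is a bridge, recolour one side. Otherwise the other face at \<open>uv\<close> is a triangle
  \<open>uvw\<close>. If \<open>w\<close> is inner, the 2-regular graph on \<open>N(w)\<close> has a 2-colouring with the single
  monochromatic edge \<open>uv\<close>, which forces odd degree. If \<open>w\<close> is on the outer face, then \<open>w\<close> separates
  \<open>u\<close> from \<open>v\<close> in the rest: a path avoiding \<open>w\<close> closes up with \<open>uv\<close> to a Jordan curve that has the
  triangle and the outer face on different sides, although \<open>w\<close> is on the boundary of both. So one side
  can be recoloured. Finally, a 3-colourable graph is represented by a concatenation of words, one for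
  each non-edge, that keep all edges alternating in the direction of increasing colour.
\<close>

section \<open>Words\<close>

text \<open>Count differences are additive, so the excess of \<open>x\<close> over \<open>y\<close>
  follows from the excesses of both over a third letter. This is what makes alternation comparable
  between neighbours of a common vertex.\<close>

definition prefix_excess :: "'v \<Rightarrow> 'v \<Rightarrow> 'v list \<Rightarrow> nat \<Rightarrow> int" where
  "prefix_excess x y w n = int (count_list (take n w) x) - int (count_list (take n w) y)"

lemma prefix_excess_0 [simp]: "prefix_excess x y w 0 = 0"
  by (simp add: prefix_excess_def)

lemma alternate_iff_successively:
  "alternate w x y \<longleftrightarrow> successively (\<noteq>) (filter (\<lambda>z. z = x \<or> z = y) w)"
  by (simp add: alternate_def Let_def successively_conv_nth)

lemma all_nat_split: "(\<forall>n. P n) \<longleftrightarrow> P 0 \<and> (\<forall>n. P (Suc n))" for P :: "nat \<Rightarrow> bool"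
  by (metis not0_implies_Suc)

text \<open>After a leading \<open>x\<close> the excess is one minus the excess with the roles
  exchanged, so the rest has to satisfy the same condition starting with \<open>y\<close>; hence
  \<open>x\<close> and \<open>y\<close> are generalised. A leading \<open>y\<close> gives the excess
  -1 at once.\<close>

lemma alternate_first_iff:
  assumes "x \<noteq> y"
  shows "(let u = filter (\<lambda>z. z = x \<or> z = y) w in successively (\<noteq>) u \<and> (u \<noteq> [] \<longrightarrow> hd u = x))
    \<longleftrightarrow> (\<forall>n. prefix_excess x y w n \<in> {0, 1})"
  using assms
proof (induction w arbitrary: x y)
  case Nil
  then show ?case by (simp add: prefix_excess_def)
next
  case (Cons z w)
  let ?u = "filter (\<lambda>z. z = x \<or> z = y) w"
  have comm: "filter (\<lambda>z. z = y \<or> z = x) w = ?u"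
    by (rule filter_cong) auto
  have set_u: "?u \<noteq> [] \<Longrightarrow> hd ?u \<in> {x, y}"
    using hd_in_set[of ?u] by auto
  consider "z = x" | "z = y" | "z \<noteq> x" "z \<noteq> y" by blast
  then show ?case
  proof cases
    case 1
    have ex: "prefix_excess x y (z # w) (Suc n) = 1 - prefix_excess y x w n" for n
      using 1 Cons.prems by (simp add: prefix_excess_def)
    have "(\<forall>n. prefix_excess x y (z # w) n \<in> {0, 1}) \<longleftrightarrow> (\<forall>n. prefix_excess y x w n \<in> {0, 1})"
      unfolding all_nat_split[of "\<lambda>n. prefix_excess x y (z # w) n \<in> {0, 1}"] ex by auto
    also have "\<dots> \<longleftrightarrow> successively (\<noteq>) ?u \<and> (?u \<noteq> [] \<longrightarrow> hd ?u = y)"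
      using Cons.IH[of y x] Cons.prems by (simp add: Let_def comm)
    also have "\<dots> \<longleftrightarrow> successively (\<noteq>) (x # ?u)"
      using set_u Cons.prems by (auto simp: successively_Cons)
    finally show ?thesis using 1 by (simp add: Let_def)
  next
    case 2
    have "prefix_excess x y (z # w) (Suc 0) = - 1"
      using 2 Cons.prems by (simp add: prefix_excess_def)
    then have "\<not> (\<forall>n. prefix_excess x y (z # w) n \<in> {0, 1})"
      by (metis insert_iff singletonD zero_neq_neg_one one_neq_neg_one)
    then show ?thesis using 2 Cons.prems by (auto simp: Let_def)
  next
    case 3
    have "prefix_excess x y (z # w) (Suc n) = prefix_excess x y w n" for n
      using 3 by (simp add: prefix_excess_def)
    then have "(\<forall>n. prefix_excess x y (z # w) n \<in> {0, 1}) \<longleftrightarrow> (\<forall>n. prefix_excess x y w n \<in> {0, 1})"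
      unfolding all_nat_split[of "\<lambda>n. prefix_excess x y (z # w) n \<in> {0, 1}"] by simp
    then show ?thesis using 3 Cons.IH[of x y] Cons.prems by (simp add: Let_def)
  qed
qed

text \<open>The two disjuncts record which of the two letters comes first.\<close>

lemma alternate_iff_prefix_excess:
  assumes "x \<noteq> y"
  shows "alternate w x y \<longleftrightarrow>
    (\<forall>n. prefix_excess x y w n \<in> {0, 1}) \<or> (\<forall>n. prefix_excess x y w n \<in> {-1, 0})"
proof -
  let ?u = "filter (\<lambda>z. z = x \<or> z = y) w"
  have comm: "filter (\<lambda>z. z = y \<or> z = x) w = ?u"
    by (rule filter_cong) auto
  have set_u: "?u \<noteq> [] \<Longrightarrow> hd ?u \<in> {x, y}"
    using hd_in_set[of ?u] by auto
  have sw: "prefix_excess y x w n \<in> {0, 1} \<longleftrightarrow> prefix_excess x y w n \<in> {-1, 0}" for n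
    by (auto simp: prefix_excess_def)
  have "alternate w x y \<longleftrightarrow> (successively (\<noteq>) ?u \<and> (?u \<noteq> [] \<longrightarrow> hd ?u = x)) \<or>
      (successively (\<noteq>) ?u \<and> (?u \<noteq> [] \<longrightarrow> hd ?u = y))"
    using set_u by (auto simp: alternate_iff_successively)
  then show ?thesis
    using alternate_first_iff[OF assms, of w] alternate_first_iff[OF assms[symmetric], of w]
    by (simp only: Let_def comm sw)
qed

section \<open>Neighbourhoods in word-representable graphs\<close>

lemma neighbourhood_bipartite:
  fixes V :: "'v set"
  assumes graph: "simple_graph V adj" and word: "word_representable V adj"
    and K4: "\<not> contains_K4 V adj"
  obtains f :: "'v \<Rightarrow> bool"
  where "\<And>x y. adj v x \<Longrightarrow> adj v y \<Longrightarrow> adj x y \<Longrightarrow> f x \<noteq> f y"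
proof -
  obtain w where w: "set w = V"
    and alt: "\<And>x y. x \<in> V \<Longrightarrow> y \<in> V \<Longrightarrow> x \<noteq> y \<Longrightarrow> alternate w x y \<longleftrightarrow> adj x y"
    using word unfolding word_representable_def by blast
  have adjV: "\<And>x y. adj x y \<Longrightarrow> x \<in> V \<and> y \<in> V \<and> x \<noteq> y \<and> adj y x"
    using graph unfolding simple_graph_def by blast
  \<comment> \<open>The shift is 0 if \<open>x\<close> comes before \<open>v\<close> in the word and
    1 if it comes after.\<close>
  have "\<exists>s. \<forall>n. prefix_excess x v w n + s \<in> {0, 1}" if vx: "adj v x" for x
  proof -
    have "alternate w x v" using vx adjV alt by metis
    then consider "\<forall>n. prefix_excess x v w n \<in> {0, 1}" | "\<forall>n. prefix_excess x v w n \<in> {-1, 0}"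
      using alternate_iff_prefix_excess[of x v w] adjV[OF vx] by auto
    then show ?thesis
    proof cases
      case 1 then show ?thesis by (intro exI[of _ 0]) simp
    next
      case 2
      have "prefix_excess x v w n + 1 \<in> {0, 1}" for n using spec[OF 2, of n] by simp linarith
      then show ?thesis by blast
    qed
  qed
  then have "\<forall>x. \<exists>s. adj v x \<longrightarrow> (\<forall>n. prefix_excess x v w n + s \<in> {0, 1})"
    by blast
  then obtain s where s: "\<And>x n. adj v x \<Longrightarrow> prefix_excess x v w n + s x \<in> {0, 1}"
    using choice[of "\<lambda>x s. adj v x \<longrightarrow> (\<forall>n. prefix_excess x v w n + s \<in> {0, 1})"] by blast
  define e where "e x n = prefix_excess x v w n + s x" for x n
  define le where "le x y \<longleftrightarrow> (\<forall>n. e x n \<le> e y n)" for x y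
  have diff: "e x n - e y n = prefix_excess x y w n + (s x - s y)" for x y n
    by (simp add: e_def prefix_excess_def)
  have e01: "adj v x \<Longrightarrow> e x n = 0 \<or> e x n = 1" for x n
    using s[of x n] by (auto simp: e_def)
  \<comment> \<open>Along an edge \<open>e x n - e y n\<close> takes only two consecutive integer
    values, so it cannot change sign.\<close>
  have adj_le: "le x y \<or> le y x" if xy: "adj v x" "adj v y" "adj x y" for x y
  proof -
    have "alternate w x y" using xy adjV alt by metis
    then consider "\<forall>n. prefix_excess x y w n \<in> {0, 1}" | "\<forall>n. prefix_excess x y w n \<in> {-1, 0}"
      using alternate_iff_prefix_excess[of x y w] adjV[OF xy(3)] by auto
    then have "\<exists>k. \<forall>n. e x n - e y n = k \<or> e x n - e y n = k + 1"
    proof cases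
      case 1 then show ?thesis by (intro exI[of _ "s x - s y"]) (auto simp: diff)
    next
      case 2
      then have "\<forall>n. e x n - e y n = s x - s y - 1 \<or> e x n - e y n = s x - s y"
        by (fastforce simp: diff)
      then show ?thesis by (intro exI[of _ "s x - s y - 1"]) simp
    qed
    then obtain k where k: "\<forall>n. e x n - e y n = k \<or> e x n - e y n = k + 1" ..
    show ?thesis
    proof (cases "k \<ge> 0")
      case True
      then have "e y n \<le> e x n" for n using spec[OF k, of n] by linarith
      then show ?thesis unfolding le_def by blast
    next
      case False
      then have "e x n \<le> e y n" for n using spec[OF k, of n] by linarith
      then show ?thesis unfolding le_def by blast
    qed
  qed
  \<comment> \<open>Conversely, for comparable 0/1 functions the difference takes only the values 0
    and 1. Undoing the shifts leaves two consecutive values, one of which is the initial excess 0,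
    so they are \<open>{0, 1}\<close> or \<open>{-1, 0}\<close>.\<close>
  have le_adj: "adj x y" if "adj v x" "adj v y" "x \<noteq> y" "le x y" for x y
  proof -
    have le: "e x n \<le> e y n" for n using that(4) unfolding le_def by blast
    have e01_diff: "e y n - e x n = 0 \<or> e y n - e x n = 1" for n
      using e01[OF that(1), of n] e01[OF that(2), of n] le[of n] by linarith
    have "prefix_excess y x w n = s x - s y \<or> prefix_excess y x w n = s x - s y + 1" for n
      using diff[of y n x] e01_diff[of n] by linarith
    moreover from this[of 0] have "s x - s y = 0 \<or> s x - s y = -1" by simp linarith
    ultimately have "(\<forall>n. prefix_excess y x w n \<in> {0, 1}) \<or> (\<forall>n. prefix_excess y x w n \<in> {-1, 0})"
      by fastforce
    then have "alternate w y x"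
      using alternate_iff_prefix_excess[of y x w] that(3) by simp
    then show ?thesis using alt adjV that by metis
  qed
  \<comment> \<open>Equal functions would force the excess of \<open>x\<close> over \<open>y\<close>
    to be constant, but it jumps at each occurrence of \<open>x\<close>.\<close>
  have anti: False if vx: "adj v x" "x \<noteq> y" "le x y" "le y x" for x y
  proof -
    have c: "prefix_excess x y w n = 0" for n
    proof -
      have "e x n = e y n" "e x 0 = e y 0" using vx unfolding le_def by (auto intro: antisym)
      then show ?thesis using diff[of x n y] diff[of x 0 y] by simp
    qed
    obtain i where i: "i < length w" "w ! i = x"
      using adjV[OF vx(1)] w by (metis in_set_conv_nth)
    then have "prefix_excess x y w (Suc i) = prefix_excess x y w i + 1"
      using vx(2) by (simp add: prefix_excess_def take_Suc_conv_app_nth)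
    with c show False by simp
  qed
  \<comment> \<open>\<open>f\<close> marks the elements that are not maximal. Without chains of
    length three, the larger end of an edge is maximal and the smaller one is not.\<close>
  define f where "f x \<longleftrightarrow> (\<exists>y. adj v y \<and> y \<noteq> x \<and> le x y)" for x
  \<comment> \<open>By transitivity three elements of a chain are pairwise adjacent, and together
    with \<open>v\<close> they form a \<open>K4\<close>.\<close>
  have no_chain: False if "adj v x" "adj v y" "adj x y" "le x y" "f y" for x y
  proof -
    obtain z where z: "adj v z" "z \<noteq> y" "le y z" using \<open>f y\<close> f_def by blast
    show False
    proof (cases "z = x")
      case True then show False using anti z that adjV by metis
    next
      case False
      have "le x z" using \<open>le x y\<close> \<open>le y z\<close> unfolding le_def by (meson order_trans)
      then have "adj x z" "adj y z" using le_adj False z that by metis+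
      then have "contains_K4 V adj"
        unfolding contains_K4_def using that z adjV
        by (intro bexI[of _ v] bexI[of _ x] bexI[of _ y] bexI[of _ z]) auto
      with K4 show False ..
    qed
  qed
  show thesis
  proof
    fix x y assume xy: "adj v x" "adj v y" "adj x y"
    show "f x \<noteq> f y"
    proof (cases "le x y")
      case True
      then have "f x" using xy adjV f_def by metis
      then show ?thesis using no_chain xy True by blast
    next
      case False
      then have l: "le y x" using adj_le xy by blast
      then have "f y" using xy adjV f_def by metis
      then show ?thesis using no_chain[of y x] xy l adjV by blast
    qed
  qed
qed

section \<open>Words for 3-colourable graphs\<close>

text \<open>Powers of \<open>xy\<close>, rather than just alternation of \<open>x\<close> and \<open>y\<close>, are stable under concatenation.\<close>
definition colour_block :: "('v \<Rightarrow> 'v \<Rightarrow> bool) \<Rightarrow> ('v \<Rightarrow> nat) \<Rightarrow> 'v list \<Rightarrow> bool" where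
  "colour_block adj c w \<longleftrightarrow> (\<forall>x y. adj x y \<longrightarrow> c x < c y \<longrightarrow>
     (\<exists>k. filter (\<lambda>z. z = x \<or> z = y) w = concat (replicate k [x, y])))"

lemma colour_block_concat:
  assumes "\<And>w. w \<in> set ws \<Longrightarrow> colour_block adj c w"
  shows "colour_block adj c (concat ws)"
  using assms
proof (induction ws)
  case Nil
  then show ?case by (auto simp: colour_block_def intro: exI[of _ 0])
next
  case (Cons w ws)
  then have w: "colour_block adj c w" and ws: "colour_block adj c (concat ws)" by auto
  show ?case
    unfolding colour_block_def
  proof (intro allI impI)
    fix x y assume "adj x y" "c x < c y"
    then obtain k l where "filter (\<lambda>z. z = x \<or> z = y) w = concat (replicate k [x, y])"
      "filter (\<lambda>z. z = x \<or> z = y) (concat ws) = concat (replicate l [x, y])"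
      using w ws unfolding colour_block_def by blast
    then have "filter (\<lambda>z. z = x \<or> z = y) (concat (w # ws)) = concat (replicate (k + l) [x, y])"
      by (simp add: replicate_add)
    then show "\<exists>k. filter (\<lambda>z. z = x \<or> z = y) (concat (w # ws)) = concat (replicate k [x, y])" ..
  qed
qed

lemma colour_block_alternate:
  assumes "colour_block adj c w" "adj x y" "c x < c y" "x \<noteq> y"
  shows "alternate w x y"
proof -
  have "successively (\<noteq>) (concat (replicate k [x, y])) \<and>
      (k \<noteq> 0 \<longrightarrow> hd (concat (replicate k [x, y])) = x)" for k
    using \<open>x \<noteq> y\<close> by (induction k) (auto simp: successively_Cons)
  moreover obtain k where "filter (\<lambda>z. z = x \<or> z = y) w = concat (replicate k [x, y])"
    using assms unfolding colour_block_def by blast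
  ultimately show ?thesis
    unfolding alternate_iff_successively by simp
qed

lemma alternate_commute: "alternate w x y \<longleftrightarrow> alternate w y x"
  by (simp add: alternate_def disj_commute)

text \<open>A repetition in the filtered word persists in any longer word, so one block per non-edge
  is enough to destroy its alternation.\<close>

lemma not_alternate_append:
  "\<not> alternate w x y \<Longrightarrow> \<not> alternate (us @ w @ vs) x y"
  by (auto simp: alternate_iff_successively successively_append_iff)

lemma filter_pair_distinct:
  assumes "distinct xs" "x \<in> set xs" "y \<notin> set xs"
  shows "filter (\<lambda>z. z = x \<or> z = y) xs = [x]" "filter (\<lambda>z. z = y \<or> z = x) xs = [x]"
  using assms by (induction xs) (auto simp: filter_empty_conv intro: filter_False)

lemma three_colourable_word_representable:
  fixes V :: "'v set"
  assumes graph: "simple_graph V adj"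
    and range: "\<And>x. c x < (3::nat)" and col: "\<And>x y. adj x y \<Longrightarrow> c x \<noteq> c y"
  shows "word_representable V adj"
proof -
  have fin: "finite V" using graph by (simp add: simple_graph_def)
  have adjV: "\<And>x y. adj x y \<Longrightarrow> x \<in> V \<and> y \<in> V \<and> x \<noteq> y \<and> adj y x"
    using graph unfolding simple_graph_def by blast
  define L where "L i = (SOME l. set l = {x \<in> V. c x = i} \<and> distinct l)" for i
  have L: "set (L i) = {x \<in> V. c x = i}" "distinct (L i)" for i
    using someI_ex[OF finite_distinct_list[of "{x \<in> V. c x = i}"]] fin unfolding L_def by auto
  have c3: "c x = 0 \<or> c x = 1 \<or> c x = 2" for x
    using range[of x] by linarith
  have mem: "x \<in> set (L i) \<longleftrightarrow> x \<in> V \<and> c x = i" for x i by (simp add: L)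
  let ?p = "\<lambda>x y. \<lambda>z. z = x \<or> z = y"
  \<comment> \<open>Removing \<open>a\<close> from its colour class allows it to be placed elsewhere
    in a block.\<close>
  define R where "R a i = filter (\<lambda>z. z \<noteq> a) (L i)" for a i
  have fL: "filter (?p x y) (L i) = (if c x = i then [x] else if c y = i then [y] else [])"
    if "x \<in> V" "y \<in> V" "c x \<noteq> c y" for x y i
    using that L filter_pair_distinct[of "L i" x y] filter_pair_distinct[of "L i" y x]
    by (auto simp: filter_empty_conv)
  have fR: "filter (?p x y) (R a i) = (if c x = i \<and> x \<noteq> a then [x] else if c y = i \<and> y \<noteq> a then [y] else [])"
    if "x \<in> V" "y \<in> V" "c x \<noteq> c y" for x y a i
  proof -
    have "filter (?p x y) (R a i) = filter (\<lambda>z. z \<noteq> a) (filter (?p x y) (L i))"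
      by (simp add: R_def conj_commute)
    then show ?thesis using that by (auto simp: fL)
  qed
  have two: "\<exists>k. [x, y, x, y] = concat (replicate k [x, y])" for x y :: 'v
    by (rule exI[of _ 2]) (simp add: numeral_2_eq_2)
  \<comment> \<open>Every block built below contains two copies of each vertex, which is where the
    exponent 2 comes from.\<close>
  have blockI: "colour_block adj c w"
    if "\<And>x y. adj x y \<Longrightarrow> x \<in> V \<Longrightarrow> y \<in> V \<Longrightarrow> c x < c y \<Longrightarrow> filter (?p x y) w = [x, y, x, y]" for w
    unfolding colour_block_def using that two adjV by simp
  have c_less: "c x = 0 \<and> c y = 1 \<or> c x = 0 \<and> c y = 2 \<or> c x = 1 \<and> c y = 2" if "c x < c y" for x y
    using c3[of x] c3[of y] that by auto
  have nonedge: "\<exists>w. set w \<subseteq> V \<and> colour_block adj c w \<and> \<not> alternate w x y"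
    if xy: "x \<in> V" "y \<in> V" "x \<noteq> y" "\<not> adj x y" and le: "c x \<le> c y" for x y
  proof -
    consider "c x = c y" | "c x = 0" "c y = 1" | "c x = 1" "c y = 2" | "c x = 0" "c y = 2"
      using le c_less[of x y] by linarith
    then show ?thesis
    proof cases
      case 1
      \<comment> \<open>Reversing each class in the second half affects only pairs of equal colour.
        The filtered word is then \<open>?u @ rev ?u\<close>, whose middle letter is
        doubled.\<close>
      let ?w = "(L 0 @ L 1 @ L 2) @ (rev (L 0) @ rev (L 1) @ rev (L 2))"
      let ?u = "filter (?p x y) (L (c x))"
      have "filter (?p x y) (L i) = []" if "i \<noteq> c x" for i
        using that 1 by (auto simp: filter_empty_conv mem)
      then have "filter (?p x y) ?w = ?u @ rev ?u"
        using c3[of x] by (auto simp flip: rev_filter)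
      moreover have "?u \<noteq> []" using xy by (auto simp: filter_empty_conv mem)
      ultimately have "\<not> alternate ?w x y"
        by (simp add: alternate_iff_successively successively_append_iff hd_rev)
      moreover have "colour_block adj c ?w"
        by (rule blockI) (use c_less in \<open>fastforce simp: fL simp flip: rev_filter\<close>)
      moreover have "set ?w \<subseteq> V" by (auto simp: mem)
      ultimately show ?thesis by blast
    next
      case 2
      \<comment> \<open>In the second half \<open>x\<close> is moved to the end of its class and
        \<open>y\<close> to the front of the next one, and then the two are exchanged; among
        differently coloured pairs only this one changes its order.\<close>
      let ?w = "L 0 @ L 1 @ L 2 @ R x 0 @ [y] @ [x] @ R y 1 @ L 2"
      have "filter (?p x y) ?w = [x, y, y, x]" using 2 xy by (simp add: fL fR)
      then have "\<not> alternate ?w x y" by (simp add: alternate_iff_successively)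
      moreover have "colour_block adj c ?w"
      proof (rule blockI)
        fix a b assume "adj a b" "a \<in> V" "b \<in> V" "c a < c b"
        moreover from this have "\<not> (a = x \<and> b = y)" using xy by blast
        ultimately show "filter (?p a b) ?w = [a, b, a, b]"
          using c_less[of a b] 2 by (auto simp: fL fR)
      qed
      moreover have "set ?w \<subseteq> V" using xy by (auto simp: mem R_def)
      ultimately show ?thesis by blast
    next
      case 3
      let ?w = "L 0 @ L 1 @ L 2 @ L 0 @ R x 1 @ [y] @ [x] @ R y 2"
      have "filter (?p x y) ?w = [x, y, y, x]" using 3 xy by (simp add: fL fR)
      then have "\<not> alternate ?w x y" by (simp add: alternate_iff_successively)
      moreover have "colour_block adj c ?w"
      proof (rule blockI)
        fix a b assume "adj a b" "a \<in> V" "b \<in> V" "c a < c b"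
        moreover from this have "\<not> (a = x \<and> b = y)" using xy by blast
        ultimately show "filter (?p a b) ?w = [a, b, a, b]"
          using c_less[of a b] 3 by (auto simp: fL fR)
      qed
      moreover have "set ?w \<subseteq> V" using xy by (auto simp: mem R_def)
      ultimately show ?thesis by blast
    next
      case 4
      \<comment> \<open>A directed path may join \<open>x\<close> to \<open>y\<close> through the middle colour, so no pair of permutations
        separates them; here the second \<open>x\<close> is moved forward past the first \<open>y\<close>.\<close>
      let ?w = "L 0 @ L 1 @ R y 2 @ [x] @ [y] @ R x 0 @ L 1 @ L 2"
      have "filter (?p x y) ?w = [x, x, y, y]" using 4 xy by (simp add: fL fR)
      then have "\<not> alternate ?w x y" by (simp add: alternate_iff_successively)
      moreover have "colour_block adj c ?w"
      proof (rule blockI)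
        fix a b assume "adj a b" "a \<in> V" "b \<in> V" "c a < c b"
        moreover from this have "\<not> (a = x \<and> b = y)" using xy by blast
        ultimately show "filter (?p a b) ?w = [a, b, a, b]"
          using c_less[of a b] 4 by (auto simp: fL fR)
      qed
      moreover have "set ?w \<subseteq> V" using xy by (auto simp: mem R_def)
      ultimately show ?thesis by blast
    qed
  qed
  have nonedge': "\<exists>w. set w \<subseteq> V \<and> colour_block adj c w \<and> \<not> alternate w x y"
    if "x \<in> V" "y \<in> V" "x \<noteq> y" "\<not> adj x y" for x y
    using that nonedge[of x y] nonedge[of y x] alternate_commute[of _ x y] adjV
    by (metis nat_le_linear)
  define P where "P = {(x, y). x \<in> V \<and> y \<in> V \<and> x \<noteq> y \<and> \<not> adj x y}"
  define \<beta> where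
    "\<beta> = (\<lambda>(x, y). SOME w. set w \<subseteq> V \<and> colour_block adj c w \<and> \<not> alternate w x y)"
  have \<beta>: "set (\<beta> (x, y)) \<subseteq> V \<and> colour_block adj c (\<beta> (x, y)) \<and> \<not> alternate (\<beta> (x, y)) x y"
    if "(x, y) \<in> P" for x y
    unfolding \<beta>_def prod.case by (rule someI_ex, rule nonedge') (use that in \<open>auto simp: P_def\<close>)
  have "finite P" unfolding P_def
    by (rule finite_subset[of _ "V \<times> V"]) (auto simp: fin)
  then obtain ps where ps: "set ps = P" using finite_list by blast
  \<comment> \<open>The base block guarantees that every vertex occurs, even if there are no
    non-edges.\<close>
  define base where "base = L 0 @ L 1 @ L 2 @ L 0 @ L 1 @ L 2"
  define w where "w = concat (base # map \<beta> ps)"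
  have "x \<in> set base \<longleftrightarrow> x \<in> V" for x using c3[of x] by (auto simp: base_def mem)
  then have "set base = V" by blast
  then have "set w = V" using \<beta> ps by (fastforce simp: w_def)
  moreover have base: "colour_block adj c base"
    unfolding base_def by (rule blockI) (use c_less in \<open>fastforce simp: fL\<close>)
  have "colour_block adj c w"
    unfolding w_def by (rule colour_block_concat) (use base \<beta> ps in auto)
  then have "alternate w x y" if "adj x y" for x y
    using colour_block_alternate[of adj c w x y] colour_block_alternate[of adj c w y x]
      that col[OF that] adjV[OF that] alternate_commute[of w x y] by (metis nat_neq_iff)
  moreover have "\<not> alternate w x y" if "(x, y) \<in> P" for x y
  proof -
    obtain us vs where "ps = us @ (x, y) # vs"
      using \<open>(x, y) \<in> P\<close> ps by (metis split_list)
    then have "w = (base @ concat (map \<beta> us)) @ \<beta> (x, y) @ concat (map \<beta> vs)"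
      by (simp add: w_def)
    then show ?thesis using \<beta>[OF that] not_alternate_append by metis
  qed
  ultimately show ?thesis
    unfolding word_representable_def P_def by blast
qed

section \<open>Attaching an arc to a compact set in the plane\<close>

text \<open>A nonempty open piece of the arc would embed into the real line, against invariance of
  dimension.\<close>

lemma interior_arc_image_empty:
  fixes g :: "real \<Rightarrow> complex"
  assumes "arc g"
  shows "interior (path_image g) = {}"
proof (rule ccontr)
  assume ne: "interior (path_image g) \<noteq> {}"
  obtain h where h: "homeomorphism {0..1} (path_image g) g h"
    using homeomorphism_arc[OF assms] by blast
  have "inj_on h (path_image g)"
    using h by (metis homeomorphism_def inj_on_inverseI)
  then have "inj_on h (interior (path_image g))"
    using interior_subset inj_on_subset by blast
  moreover have "continuous_on (interior (path_image g)) h"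
    using h interior_subset continuous_on_subset unfolding homeomorphism_def by blast
  ultimately have "DIM(complex) \<le> DIM(real)"
    using invariance_of_dimension[of "interior (path_image g)" h] ne by blast
  then show False by simp
qed

lemma arc_image_minus_endpoints:
  assumes "arc g"
  shows "path_image g - {pathstart g, pathfinish g} = g ` {0<..<1}"
proof -
  have inj: "inj_on g {0..1}" using assms by (simp add: arc_def)
  have "{0<..<1} = {0..1} - {0, 1::real}" by auto
  then have "g ` {0<..<1} = g ` {0..1} - g ` {0, 1}"
    using inj_on_image_set_diff[OF inj, of "{0..1}" "{0, 1}"] by simp
  then show ?thesis by (simp add: path_image_def pathstart_def pathfinish_def)
qed

lemma arc_image_subset_closure:
  assumes "arc g"
  shows "path_image g \<subseteq> closure (path_image g - {pathstart g, pathfinish g})"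
proof -
  have "continuous_on {0..1} g" using assms by (simp add: arc_def path_def)
  then have "g ` closure {0<..<1} \<subseteq> closure (g ` {0<..<1})"
    by (intro image_closure_subset) (auto intro: closure_subset[THEN subsetD])
  then show ?thesis
    by (simp add: arc_image_minus_endpoints[OF assms]) (simp add: path_image_def)
qed

lemma connected_arc_image_minus_endpoints:
  assumes "arc g"
  shows "connected (path_image g - {pathstart g, pathfinish g})"
proof -
  have "continuous_on {0<..<1} g"
    using assms unfolding arc_def path_def
    by (meson continuous_on_subset greaterThanLessThan_subseteq_atLeastAtMost_iff order_refl)
  then have "connected (g ` {0<..<1})" by (rule connected_continuous_image) simp
  then show ?thesis by (simp add: arc_image_minus_endpoints[OF assms])
qed

lemma arc_image_minus_endpoints_nonempty:
  assumes "arc g"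
  shows "path_image g - {pathstart g, pathfinish g} \<noteq> {}"
  by (simp add: arc_image_minus_endpoints[OF assms])

lemma connected_subset_of_frontier_disjoint:
  assumes "connected C" "C \<inter> A \<noteq> {}" "C \<inter> frontier A = {}"
  shows "C \<subseteq> A"
  using connected_Int_frontier[of C A] assms by blast

text \<open>A connected set that meets a side of the curve and has no frontier point there contains
  that whole side. Boundedness rules out the outside, so both sets are the inside.\<close>

lemma bounded_frontier_Jordan_unique:
  fixes c :: "real \<Rightarrow> complex"
  assumes c: "simple_path c" "pathfinish c = pathstart c"
    and A: "open A" "connected A" "A \<noteq> {}" "bounded A" "frontier A = path_image c"
    and B: "open B" "connected B" "B \<noteq> {}" "bounded B" "frontier B = path_image c"
  shows "A = B"
proof -
  obtain inner outer where J: "connected inner" "connected outer" "\<not> bounded outer"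
    "inner \<inter> outer = {}" "inner \<union> outer = - path_image c"
    "frontier inner = path_image c" "frontier outer = path_image c"
    using Jordan_curve[OF c] by metis
  have "X = inner" if X: "open X" "connected X" "X \<noteq> {}" "bounded X" "frontier X = path_image c" for X
  proof -
    have dis: "X \<inter> path_image c = {}"
      using X(1,5) frontier_disjoint_eq by blast
    have "X \<inter> outer = {}"
    proof (rule ccontr)
      assume "X \<inter> outer \<noteq> {}"
      then have "outer \<subseteq> X"
        using J(5) X(5) by (intro connected_subset_of_frontier_disjoint[OF J(2)]) auto
      then show False using J(3) X(4) bounded_subset by blast
    qed
    then have "X \<subseteq> inner" using dis J(5) by blast
    moreover have "inner \<subseteq> X"
      using J(5) X(3,5) \<open>X \<subseteq> inner\<close> by (intro connected_subset_of_frontier_disjoint[OF J(1)]) auto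
    ultimately show ?thesis by blast
  qed
  from this[OF A] this[OF B] show ?thesis by simp
qed

section \<open>Complementary components after adding a set or an arc\<close>

text \<open>Outside \<open>K\<close> the added set lies in \<open>F\<close> only, so all other
  components survive. The claimed family is a partition into nonempty connected open sets, and such
  a partition is unique.\<close>

lemma components_attach_closed:
  fixes K E :: "complex set"
  assumes "closed K" "closed E" and F: "F \<in> components (- K)" and E: "E \<subseteq> K \<union> F"
  shows "components (- (K \<union> E)) = (components (- K) - {F}) \<union> components (F - E)"
proof (rule components_open_unique)
  have opF: "open C" if "C \<in> components (- K)" for C
    using that \<open>closed K\<close> open_components by blast
  have opFE: "open (F - E)" using opF[OF F] \<open>closed E\<close> by blast
  have dis: "C = D" if "C \<in> components S" "D \<in> components S" "C \<inter> D \<noteq> {}" for C D and S :: "complex set"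
    using components_eq[OF that(1,2)] that(3) by simp
  show "pairwise disjnt (components (- K) - {F} \<union> components (F - E))"
    unfolding pairwise_def disjnt_def
  proof (intro ballI impI)
    fix C D assume C: "C \<in> components (- K) - {F} \<union> components (F - E)"
      and D: "D \<in> components (- K) - {F} \<union> components (F - E)" and "C \<noteq> D"
    have sub: "X \<subseteq> F" if "X \<in> components (F - E)" for X
      using in_components_subset[OF that] by auto
    have dF: "X \<inter> F = {}" if "X \<in> components (- K) - {F}" for X
      using that F dis[of X "- K" F] by auto
    show "C \<inter> D = {}"
    proof (rule ccontr)
      assume CD: "C \<inter> D \<noteq> {}"
      from C D show False
      proof (elim UnE)
        assume "C \<in> components (- K) - {F}" "D \<in> components (- K) - {F}"
        then show False using dis[of C "- K" D] CD \<open>C \<noteq> D\<close> by simp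
      next
        assume "C \<in> components (- K) - {F}" "D \<in> components (F - E)"
        then show False using dF[of C] sub(1)[of D] CD by auto
      next
        assume "C \<in> components (F - E)" "D \<in> components (- K) - {F}"
        then show False using dF[of D] sub(1)[of C] CD by auto
      next
        assume "C \<in> components (F - E)" "D \<in> components (F - E)"
        then show False using dis[of C "F - E" D] CD \<open>C \<noteq> D\<close> by simp
      qed
    qed
  qed
  show "\<Union> (components (- K) - {F} \<union> components (F - E)) = - (K \<union> E)"
  proof -
    have "\<Union> (components (- K) - {F}) = - K - F"
    proof -
      have "C \<inter> F = {}" if "C \<in> components (- K) - {F}" for C using that F dis[of C "- K" F] by auto
      then have "\<Union> (components (- K) - {F}) \<inter> F = {}" by auto
      moreover have "\<Union> (components (- K) - {F}) \<union> F = \<Union> (components (- K))"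
        using F by blast
      then have "\<Union> (components (- K) - {F}) \<union> F = - K"
        by (simp only: Union_components)
      ultimately show ?thesis by auto
    qed
    moreover have "F \<subseteq> - K" using in_components_subset[OF F] .
    moreover have "\<Union> (components (F - E)) = F - E" by (rule Union_components)
    ultimately show ?thesis using E by (simp add: Union_Un_distrib) auto
  qed
  fix X assume "X \<in> components (- K) - {F} \<union> components (F - E)"
  then show "open X \<and> connected X \<and> X \<noteq> {}"
    using opF open_components[OF opFE] in_components_connected in_components_nonempty by blast
qed

text \<open>The curve closing \<open>e\<close> up inside \<open>K\<close> has two sides; Janiszewski's theorem says that the part of
  \<open>F\<close> on each of them stays connected, because the curve meets \<open>K\<close> in the arc \<open>\<gamma>\<close> only.\<close>
lemma components_attach_arc:
  fixes K :: "complex set"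
  assumes K: "compact K" and e: "arc e" and g: "arc \<gamma>" "path_image \<gamma> \<subseteq> K"
    and ends: "pathstart \<gamma> = pathstart e" "pathfinish \<gamma> = pathfinish e"
    and eK: "path_image e \<inter> K = {pathstart e, pathfinish e}"
    and F: "F \<in> components (- K)" and eF: "path_image e - {pathstart e, pathfinish e} \<subseteq> F"
  obtains A B where "components (F - path_image e) = {A, B}" "A \<noteq> B"
    "path_image e \<subseteq> closure A" "path_image e \<subseteq> closure B"
    "closure A \<inter> closure B \<subseteq> path_image e \<union> path_image \<gamma>"
proof -
  define J where "J = path_image e \<union> path_image \<gamma>"
  define c where "c = e +++ reversepath \<gamma>"
  have c: "simple_path c" "pathfinish c = pathstart c" "path_image c = J"
  proof -
    show "simple_path c" unfolding c_def
      by (rule simple_path_join_loop) (use e g ends eK in \<open>auto simp: arc_reversepath\<close>)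
    show "pathfinish c = pathstart c" by (simp add: c_def ends)
    show "path_image c = J" by (simp add: c_def J_def ends path_image_join)
  qed
  obtain I Q where J: "open I" "connected I" "open Q" "connected Q" "I \<inter> Q = {}" "I \<union> Q = - J"
    "frontier I = J" "frontier Q = J"
    using Jordan_curve[OF c(1,2)] c(3) by metis
  have "open F" using F K open_components compact_imp_closed by blast
  have FK: "F \<subseteq> - K" using in_components_subset[OF F] .
  have "path_image e \<inter> K \<subseteq> path_image \<gamma>"
    unfolding eK using pathstart_in_path_image[of \<gamma>] pathfinish_in_path_image[of \<gamma>] ends by simp
  then have JK: "J \<inter> K = path_image \<gamma>" unfolding J_def using g(2) by auto
  have closedJ: "closed J" unfolding J_def
    using e g by (simp add: closed_arc_image closed_Un)
  have Fe: "F - path_image e = F - J" unfolding J_def using g(2) FK by blast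
  have side: "connected (F \<inter> S)" "path_image e \<subseteq> closure (F \<inter> S)" "F \<inter> S \<noteq> {}"
    if S: "open S" "connected S" "S \<subseteq> - J" "frontier S = J" for S
  proof -
    have "connected_component (F \<inter> S) x y" if xy: "x \<in> F \<inter> S" "y \<in> F \<inter> S" for x y
    proof -
      have "connected_component (- K) x y"
        unfolding connected_component_def using xy FK in_components_connected[OF F] by (intro exI[of _ F]) auto
      moreover have "connected_component (- J) x y"
        unfolding connected_component_def using xy S by (intro exI[of _ S]) auto
      ultimately have "connected_component (- (K \<union> J)) x y"
        using Janiszewski[OF K closedJ] JK g(1) by (simp add: Int_commute connected_arc_image)
      then obtain t where t: "connected t" "t \<subseteq> - (K \<union> J)" "x \<in> t" "y \<in> t"
        unfolding connected_component_def by blast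
      moreover have "t \<subseteq> F" using components_maximal[OF F t(1)] t(2,3) xy by auto
      moreover have "t \<subseteq> S"
        using t(2,3) xy S(4) by (intro connected_subset_of_frontier_disjoint[OF t(1)]) auto
      ultimately show ?thesis unfolding connected_component_def by blast
    qed
    then show "connected (F \<inter> S)" by (simp add: connected_iff_connected_component)
    \<comment> \<open>Interior points of \<open>e\<close> lie in the open set \<open>F\<close> and
      on the frontier of the side \<open>S\<close>, so they are limits of
      \<open>F \<inter> S\<close>.\<close>
    have "path_image e - {pathstart e, pathfinish e} \<subseteq> closure (F \<inter> S)"
    proof
      fix p assume p: "p \<in> path_image e - {pathstart e, pathfinish e}"
      then have "p \<in> F" "p \<in> closure S" using eF S(4) by (auto simp: J_def frontier_def)
      then show "p \<in> closure (F \<inter> S)"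
        using open_Int_closure_subset[OF \<open>open F\<close>, of S] by blast
    qed
    then show eS: "path_image e \<subseteq> closure (F \<inter> S)"
      using arc_image_subset_closure[OF e] closure_minimal[OF _ closed_closure] by (meson order_trans)
    then show "F \<inter> S \<noteq> {}" using path_image_nonempty[of e] by auto
  qed
  have I: "connected (F \<inter> I)" "path_image e \<subseteq> closure (F \<inter> I)" "F \<inter> I \<noteq> {}"
    using side[of I] J by auto
  have Q: "connected (F \<inter> Q)" "path_image e \<subseteq> closure (F \<inter> Q)" "F \<inter> Q \<noteq> {}"
    using side[of Q] J by auto
  show thesis
  proof
    show "components (F - path_image e) = {F \<inter> I, F \<inter> Q}"
      by (rule components_open_unique)
        (use I Q J \<open>open F\<close> in \<open>auto simp: Fe pairwise_def disjnt_def\<close>)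
    show "F \<inter> I \<noteq> F \<inter> Q" using I(3) J(5) by blast
    show "path_image e \<subseteq> closure (F \<inter> I)" "path_image e \<subseteq> closure (F \<inter> Q)" by fact+
    \<comment> \<open>Each part stays on its own side of the curve, so the closures can meet only on
      the curve itself.\<close>
    have "closure (F \<inter> I) \<subseteq> I \<union> J" "closure (F \<inter> Q) \<subseteq> Q \<union> J"
      using J closure_mono[of "F \<inter> I" I] closure_mono[of "F \<inter> Q" Q] closure_Un_frontier[of I] closure_Un_frontier[of Q] by auto
    then show "closure (F \<inter> I) \<inter> closure (F \<inter> Q) \<subseteq> path_image e \<union> path_image \<gamma>"
      using J(5) unfolding J_def by blast
  qed
qed

section \<open>Plane graphs\<close>

definition del_edge :: "('v \<Rightarrow> 'v \<Rightarrow> bool) \<Rightarrow> 'v \<Rightarrow> 'v \<Rightarrow> 'v \<Rightarrow> 'v \<Rightarrow> bool" where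
  "del_edge adj u v x y \<longleftrightarrow> adj x y \<and> {x, y} \<noteq> {u, v}"

lemma faces_eq_components: "faces V adj pos cv = components (- drawing V adj pos cv)"
  by (auto simp: faces_def components_def)

locale plane_graph =
  fixes V :: "'v set" and adj :: "'v \<Rightarrow> 'v \<Rightarrow> bool"
    and pos :: "'v \<Rightarrow> complex" and cv :: "'v \<Rightarrow> 'v \<Rightarrow> real \<Rightarrow> complex"
  assumes graph: "simple_graph V adj" and embedding: "plane_embedding V adj pos cv"
begin

abbreviation edge_image :: "'v \<Rightarrow> 'v \<Rightarrow> complex set" where
  "edge_image x y \<equiv> path_image (cv x y)"

abbreviation edge_interior :: "'v \<Rightarrow> 'v \<Rightarrow> complex set" where
  "edge_interior x y \<equiv> path_image (cv x y) - {pos x, pos y}"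

abbreviation face :: "complex set \<Rightarrow> bool" where
  "face F \<equiv> F \<in> faces V adj pos cv"

lemma finite_V: "finite V"
  using graph by (simp add: simple_graph_def)

lemma adjD:
  assumes "adj x y"
  shows "x \<in> V" "y \<in> V" "x \<noteq> y" "adj y x"
  using graph assms unfolding simple_graph_def by blast+

lemma edgeD:
  assumes "adj x y"
  shows "arc (cv x y)" "pathstart (cv x y) = pos x" "pathfinish (cv x y) = pos y"
    "edge_image x y = edge_image y x"
  using embedding assms unfolding plane_embedding_def by blast+

lemma pos_eq_iff: "x \<in> V \<Longrightarrow> y \<in> V \<Longrightarrow> pos x = pos y \<longleftrightarrow> x = y"
  using embedding unfolding plane_embedding_def inj_on_def by blast

lemma vertex_on_edge: "adj x y \<Longrightarrow> w \<in> V \<Longrightarrow> pos w \<in> edge_image x y \<Longrightarrow> w = x \<or> w = y"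
  using embedding unfolding plane_embedding_def by blast

lemma ends_on_edge: "adj x y \<Longrightarrow> pos x \<in> edge_image x y \<and> pos y \<in> edge_image x y"
  using edgeD[of x y] pathstart_in_path_image[of "cv x y"] pathfinish_in_path_image[of "cv x y"] by simp

lemma edges_Int:
  assumes "adj u v" "adj x y" "{u, v} \<noteq> {x, y}"
  shows "edge_image u v \<inter> edge_image x y \<subseteq> pos ` ({u, v} \<inter> {x, y})"
proof -
  have "\<forall>u v x y. adj u v \<and> adj x y \<and> {u, v} \<noteq> {x, y} \<longrightarrow>
      edge_image u v \<inter> edge_image x y \<subseteq> pos ` ({u, v} \<inter> {x, y})"
    using embedding unfolding plane_embedding_def by (elim conjE)
  then show ?thesis using assms by simp
qed

lemma edge_interior_unique:
  assumes "adj u v" "adj x y" "q \<in> edge_interior u v" "q \<in> edge_image x y"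
  shows "{x, y} = {u, v}"
proof (rule ccontr)
  assume "{x, y} \<noteq> {u, v}"
  then have "{u, v} \<noteq> {x, y}" by (rule not_sym)
  then have "q \<in> pos ` ({u, v} \<inter> {x, y})" using edges_Int[OF assms(1,2)] assms(3,4) by (meson DiffD1 IntI subsetD)
  then have "q \<in> {pos u, pos v}" by auto
  then show False using assms(3) by simp
qed

lemma edge_interior_props:
  assumes "adj u v"
  shows "edge_interior u v \<noteq> {}" "connected (edge_interior u v)"
    "edge_image u v \<subseteq> closure (edge_interior u v)"
  using edgeD(1-3)[OF assms] arc_image_minus_endpoints_nonempty[of "cv u v"]
    connected_arc_image_minus_endpoints[of "cv u v"] arc_image_subset_closure[of "cv u v"]
  by simp_all

lemma compact_drawing: "compact (drawing V adj pos cv)"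
proof -
  have "{path_image (cv u v) | u v. adj u v} \<subseteq> (\<lambda>(u, v). path_image (cv u v)) ` (V \<times> V)"
  proof clarify
    fix u v assume "adj u v"
    then have "(u, v) \<in> V \<times> V" using adjD by blast
    then show "edge_image u v \<in> (\<lambda>(u, v). edge_image u v) ` (V \<times> V)" by (rule rev_image_eqI) simp
  qed
  then have "finite {path_image (cv u v) | u v. adj u v}"
    using finite_V finite_subset by blast
  then have "compact (\<Union> {path_image (cv u v) | u v. adj u v})"
    by (rule compact_Union) (auto intro: compact_arc_image dest: edgeD(1))
  then show ?thesis
    unfolding drawing_def using finite_V by (simp add: compact_Un finite_imp_compact)
qed

lemma edge_subset_drawing: "adj x y \<Longrightarrow> edge_image x y \<subseteq> drawing V adj pos cv"
  unfolding drawing_def by blast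

lemma vertex_in_drawing: "x \<in> V \<Longrightarrow> pos x \<in> drawing V adj pos cv"
  unfolding drawing_def by blast

lemma faceD:
  assumes "face F"
  shows "open F" "connected F" "F \<noteq> {}" "F \<inter> drawing V adj pos cv = {}"
proof -
  have F: "F \<in> components (- drawing V adj pos cv)"
    using assms unfolding faces_eq_components .
  have "open (- drawing V adj pos cv)"
    using compact_imp_closed[OF compact_drawing] by (rule open_Compl)
  then show "open F" using F open_components by blast
  show "connected F" "F \<noteq> {}" "F \<inter> drawing V adj pos cv = {}"
    using in_components_connected[OF F] in_components_nonempty[OF F] in_components_subset[OF F] by auto
qed

lemma face_frontier:
  assumes "face F" "p \<in> closure F" "p \<in> drawing V adj pos cv"
  shows "p \<in> frontier F"
  using faceD[OF assms(1)] assms(2,3) by (auto simp: frontier_def interior_open)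

lemma unbounded_face_unique: "face F \<Longrightarrow> \<not> bounded F \<Longrightarrow> face G \<Longrightarrow> \<not> bounded G \<Longrightarrow> F = G"
  using cobounded_unique_unbounded_components[of "- drawing V adj pos cv" G F]
    compact_imp_bounded[OF compact_drawing] unfolding faces_eq_components by simp

lemma unbounded_face_exists: "\<exists>F. face F \<and> \<not> bounded F"
  using cobounded_unbounded_components[of "- drawing V adj pos cv"]
    compact_imp_bounded[OF compact_drawing] unfolding faces_eq_components by simp

lemma subgraph:
  assumes "\<And>x y. adj' x y \<Longrightarrow> adj x y \<and> adj' y x"
  shows "plane_graph V adj' pos cv"
proof
  show "simple_graph V adj'"
    using graph assms unfolding simple_graph_def by blast
  show "plane_embedding V adj' pos cv"
    using embedding assms unfolding plane_embedding_def by simp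
qed

section \<open>Faces under deletion of an edge\<close>

lemma del_edge_subgraph: "plane_graph V (del_edge adj u v) pos cv"
  by (rule subgraph) (auto simp: del_edge_def insert_commute dest: adjD)

lemma drawing_del_edge:
  assumes "adj u v"
  shows "drawing V adj pos cv = drawing V (del_edge adj u v) pos cv \<union> edge_image u v"
proof -
  have edge: "edge_image x y \<subseteq> drawing V (del_edge adj u v) pos cv \<union> edge_image u v" if "adj x y" for x y
  proof (cases "{x, y} = {u, v}")
    case True
    then have "edge_image x y = edge_image u v"
      using edgeD(4)[OF assms] by (auto simp: doubleton_eq_iff)
    then show ?thesis by simp
  next
    case False
    then have "del_edge adj u v x y" using that by (simp add: del_edge_def)
    then show ?thesis unfolding drawing_def by blast
  qed
  have "drawing V (del_edge adj u v) pos cv \<subseteq> drawing V adj pos cv"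
    unfolding drawing_def del_edge_def by blast
  moreover have "drawing V adj pos cv \<subseteq> drawing V (del_edge adj u v) pos cv \<union> edge_image u v"
  proof
    fix q assume "q \<in> drawing V adj pos cv"
    then consider "q \<in> pos ` V" | x y where "adj x y" "q \<in> edge_image x y"
      unfolding drawing_def by blast
    then show "q \<in> drawing V (del_edge adj u v) pos cv \<union> edge_image u v"
    proof cases
      case 1 then show ?thesis unfolding drawing_def by simp
    next
      case 2 then show ?thesis using edge[of x y] by blast
    qed
  qed
  ultimately show ?thesis
    using edge_subset_drawing[OF assms] by (intro antisym Un_least)
qed

lemma edge_Int_drawing_del_edge:
  assumes "adj u v"
  shows "edge_image u v \<inter> drawing V (del_edge adj u v) pos cv = {pos u, pos v}"
proof
  show "{pos u, pos v} \<subseteq> edge_image u v \<inter> drawing V (del_edge adj u v) pos cv"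
    using ends_on_edge[OF assms] adjD[OF assms] by (auto simp: drawing_def)
  show "edge_image u v \<inter> drawing V (del_edge adj u v) pos cv \<subseteq> {pos u, pos v}"
  proof
    fix q assume q: "q \<in> edge_image u v \<inter> drawing V (del_edge adj u v) pos cv"
    then consider w where "w \<in> V" "q = pos w" | x y where "del_edge adj u v x y" "q \<in> edge_image x y"
      unfolding drawing_def by blast
    then show "q \<in> {pos u, pos v}"
    proof cases
      case 1 then show ?thesis using vertex_on_edge[OF assms] q by blast
    next
      case 2 then show ?thesis
        using edge_interior_unique[OF assms, of x y q] q unfolding del_edge_def by blast
    qed
  qed
qed

text \<open>The interior of the edge is connected and misses the remaining drawing, so it runs
  inside a single face, and only this face is cut by the edge.\<close>

lemma deleted_face:
  assumes "adj u v"
  obtains F where "F \<in> faces V (del_edge adj u v) pos cv" "edge_interior u v \<subseteq> F"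
    "faces V adj pos cv = (faces V (del_edge adj u v) pos cv - {F}) \<union> components (F - edge_image u v)"
proof -
  let ?K = "drawing V (del_edge adj u v) pos cv"
  interpret D: plane_graph V "del_edge adj u v" pos cv by (rule del_edge_subgraph)
  have sub: "edge_interior u v \<subseteq> - ?K" using edge_Int_drawing_del_edge[OF assms] by blast
  then obtain F where F: "F \<in> components (- ?K)" "edge_interior u v \<subseteq> F"
    using exists_component_superset[of "edge_interior u v" "- ?K"] edge_interior_props[OF assms] by blast
  have "edge_image u v \<subseteq> ?K \<union> F"
    using F(2) edge_Int_drawing_del_edge[OF assms] by blast
  then have "components (- (?K \<union> edge_image u v)) = (components (- ?K) - {F}) \<union> components (F - edge_image u v)"
    using components_attach_closed[of ?K "edge_image u v" F] F D.compact_drawing edgeD(1)[OF assms]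
    by (simp add: compact_imp_closed closed_arc_image)
  then show thesis
    using that[of F] F unfolding faces_eq_components drawing_del_edge[OF assms] by simp
qed

text \<open>Faces other than the cut one are disjoint from the open set \<open>F\<close>, so their
  closures do not reach the interior of the edge.\<close>

lemma face_at_edge_interior:
  assumes "adj u v" and F: "F \<in> faces V (del_edge adj u v) pos cv" "edge_interior u v \<subseteq> F"
    "faces V adj pos cv = (faces V (del_edge adj u v) pos cv - {F}) \<union> components (F - edge_image u v)"
    and C: "face C" "q \<in> closure C" "q \<in> edge_interior u v"
  shows "C \<in> components (F - edge_image u v)"
proof (rule ccontr)
  interpret D: plane_graph V "del_edge adj u v" pos cv by (rule del_edge_subgraph)
  assume "C \<notin> components (F - edge_image u v)"
  then have "C \<in> faces V (del_edge adj u v) pos cv" "C \<noteq> F" using C(1) F(3) by auto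
  then have "C \<inter> F = {}" using F(1) components_eq[of C _ F] unfolding faces_eq_components by metis
  moreover have "q \<in> F" using C(3) F(2) by blast
  ultimately show False
    using D.faceD(1)[OF F(1)] C(2) open_Int_closure_eq_empty[of F C] by blast
qed

section \<open>Walks and the two faces at an edge\<close>

text \<open>The edges of the walk are joined to a path, which may cross itself; every path between
  distinct points contains an arc.\<close>

lemma walk_arc:
  assumes sub: "\<And>x y. adj' x y \<Longrightarrow> adj x y" and walk: "adj'\<^sup>*\<^sup>* u v" and uv: "u \<in> V" "v \<in> V" "u \<noteq> v"
  obtains \<gamma> where "arc \<gamma>" "pathstart \<gamma> = pos u" "pathfinish \<gamma> = pos v"
    "path_image \<gamma> \<subseteq> \<Union> {edge_image x y | x y. adj' x y}"
proof -
  let ?U = "\<Union> {edge_image x y | x y. adj' x y}"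
  have "adj'\<^sup>+\<^sup>+ u v" using walk \<open>u \<noteq> v\<close> by (meson rtranclpD)
  then have "\<exists>p. path p \<and> pathstart p = pos u \<and> pathfinish p = pos v \<and> path_image p \<subseteq> ?U"
  proof induction
    case (base y)
    then show ?case using edgeD[OF sub[OF base]] arc_imp_path by blast
  next
    case (step y z)
    then obtain p where p: "path p" "pathstart p = pos u" "pathfinish p = pos y" "path_image p \<subseteq> ?U"
      by blast
    have e: "arc (cv y z)" "pathstart (cv y z) = pos y" "pathfinish (cv y z) = pos z" "edge_image y z \<subseteq> ?U"
      using edgeD[OF sub[OF step(2)]] step(2) by blast+
    show ?case
      by (rule exI[of _ "p +++ cv y z"])
        (use p e in \<open>simp add: path_image_join arc_imp_path\<close>)
  qed
  then obtain p where p: "path p" "pathstart p = pos u" "pathfinish p = pos v" "path_image p \<subseteq> ?U"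
    by blast
  have "pos u \<noteq> pos v" using pos_eq_iff uv by simp
  then obtain q where "arc q" "path_image q \<subseteq> path_image p" "pathstart q = pos u" "pathfinish q = pos v"
    using path_contains_arc[OF p(1-3)] by metis
  then show thesis using that[of q] p(4) by (meson order_trans)
qed

text \<open>The walk closes up with the edge to a Jordan curve, which splits the face containing the
  edge interior. The relation \<open>adj'\<close> is kept general because it limits where the two
  closures can meet: taken as a graph avoiding a vertex \<open>w\<close>, it keeps \<open>w\<close>
  off the common boundary.\<close>

lemma two_faces:
  assumes "adj u v" and le: "adj' \<le> del_edge adj u v" and walk: "adj'\<^sup>*\<^sup>* u v"
  obtains A B where "A \<noteq> B" "face A" "face B" "edge_image u v \<subseteq> closure A" "edge_image u v \<subseteq> closure B"
    "closure A \<inter> closure B \<subseteq> edge_image u v \<union> \<Union> {edge_image x y | x y. adj' x y}"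
    "\<forall>C q. face C \<longrightarrow> q \<in> closure C \<longrightarrow> q \<in> edge_interior u v \<longrightarrow> C = A \<or> C = B"
proof -
  let ?K = "drawing V (del_edge adj u v) pos cv"
  interpret D: plane_graph V "del_edge adj u v" pos cv by (rule del_edge_subgraph)
  have sub: "\<And>x y. adj' x y \<Longrightarrow> del_edge adj u v x y" using le by blast
  obtain F where F: "F \<in> faces V (del_edge adj u v) pos cv" "edge_interior u v \<subseteq> F"
    "faces V adj pos cv = (faces V (del_edge adj u v) pos cv - {F}) \<union> components (F - edge_image u v)"
    using deleted_face[OF assms(1)] .
  obtain \<gamma> where g: "arc \<gamma>" "pathstart \<gamma> = pos u" "pathfinish \<gamma> = pos v"
    "path_image \<gamma> \<subseteq> \<Union> {edge_image x y | x y. adj' x y}"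
    using D.walk_arc[OF sub walk] adjD[OF assms(1)] by blast
  have "\<Union> {edge_image x y | x y. adj' x y} \<subseteq> ?K"
    using D.edge_subset_drawing[OF sub] by blast
  then have gK: "path_image \<gamma> \<subseteq> ?K" using g(4) by blast
  have F': "F \<in> components (- ?K)" using F(1) by (simp add: faces_eq_components)
  obtain A B where AB: "components (F - edge_image u v) = {A, B}" "A \<noteq> B"
    "edge_image u v \<subseteq> closure A" "edge_image u v \<subseteq> closure B"
    "closure A \<inter> closure B \<subseteq> edge_image u v \<union> path_image \<gamma>"
    using components_attach_arc[OF D.compact_drawing edgeD(1)[OF assms(1)] g(1) gK _ _ _ F']
      edgeD(2,3)[OF assms(1)] g(2,3) edge_Int_drawing_del_edge[OF assms(1)] F(2) by metis
  show thesis
  proof (rule that[of A B])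
    show "A \<noteq> B" "edge_image u v \<subseteq> closure A" "edge_image u v \<subseteq> closure B" by fact+
    show "face A" "face B" using F(3) AB(1) by auto
    show "closure A \<inter> closure B \<subseteq> edge_image u v \<union> \<Union> {edge_image x y | x y. adj' x y}"
      using AB(5) g(4) by blast
    show "\<forall>C q. face C \<longrightarrow> q \<in> closure C \<longrightarrow> q \<in> edge_interior u v \<longrightarrow> C = A \<or> C = B"
      using face_at_edge_interior[OF assms(1) F] AB(1) by simp
  qed
qed

text \<open>The three edges meet only in their common ends and so form a Jordan curve, which bounds
  only one bounded region.\<close>

lemma triangle_frontier_unique:
  assumes F: "face F" "bounded F" and G: "face G" "bounded G"
    and tri: "adj a b" "adj a c" "adj b c"
    and fr: "frontier F = edge_image a b \<union> edge_image a c \<union> edge_image b c" "frontier G = frontier F"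
  shows "F = G"
proof -
  have ne: "a \<noteq> b" "a \<noteq> c" "b \<noteq> c" using tri adjD by blast+
  have ca: "adj c a" using adjD(4)[OF tri(2)] .
  let ?p = "cv a b +++ (cv b c +++ cv c a)"
  have "edge_image b c \<inter> edge_image c a \<subseteq> pos ` ({b, c} \<inter> {c, a})"
    using ne by (intro edges_Int tri ca) auto
  then have i1: "edge_image b c \<inter> edge_image c a \<subseteq> {pos c}" using ne by auto
  have "edge_image a b \<inter> edge_image b c \<subseteq> pos ` ({a, b} \<inter> {b, c})"
    using ne by (intro edges_Int tri) auto
  then have i2: "edge_image a b \<inter> edge_image b c \<subseteq> {pos b}" using ne by auto
  have "edge_image a b \<inter> edge_image c a \<subseteq> pos ` ({a, b} \<inter> {c, a})"
    using ne by (intro edges_Int tri ca) auto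
  then have i3: "edge_image a b \<inter> edge_image c a \<subseteq> {pos a}" using ne by auto
  note e = edgeD[OF tri(1)] edgeD[OF tri(3)] edgeD[OF ca]
  have arc: "arc (cv b c +++ cv c a)"
    by (rule arc_join) (use e i1 in auto)
  have im: "path_image (cv b c +++ cv c a) = edge_image b c \<union> edge_image c a"
    by (rule path_image_join) (use e in simp)
  have "simple_path ?p"
    by (rule simple_path_join_loop) (use e arc im i2 i3 in auto)
  moreover have "pathfinish ?p = pathstart ?p" using e by simp
  moreover have "path_image ?p = frontier F"
    using e im fr(1) by (subst path_image_join) auto
  ultimately show ?thesis
    using bounded_frontier_Jordan_unique[of ?p F G] faceD[OF F(1)] faceD[OF G(1)] F(2) G(2) fr(2) by simp
qed

text \<open>Finitely many points do not disconnect the plane. If the frontier of the unbounded face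
  consisted of vertices only, this face would fill the rest of the plane and leave no room for the
  edge \<open>a b\<close>.\<close>

lemma outer_edge_exists:
  assumes "adj a b"
  obtains u v q F where "adj u v" "q \<in> edge_interior u v" "face F" "\<not> bounded F" "q \<in> closure F"
proof -
  obtain F where F: "face F" "\<not> bounded F" using unbounded_face_exists by blast
  have frD: "frontier F \<subseteq> drawing V adj pos cv"
  proof -
    obtain z where "F = connected_component_set (- drawing V adj pos cv) z"
      using F(1) unfolding faces_def by blast
    then have "frontier F \<subseteq> frontier (drawing V adj pos cv)"
      using frontier_of_connected_component_subset[of "- drawing V adj pos cv" z] by (simp add: frontier_complement)
    then show ?thesis
      using frontier_subset_closed[OF compact_imp_closed[OF compact_drawing]] by blast
  qed
  have "\<not> frontier F \<subseteq> pos ` V"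
  proof
    assume fr: "frontier F \<subseteq> pos ` V"
    have "connected (UNIV - pos ` V)"
      by (rule connected_open_delete_finite) (use finite_V in auto)
    then have "connected (- (pos ` V))" by (simp add: Compl_eq_Diff_UNIV)
    moreover have "F \<subseteq> - (pos ` V)" using faceD(4)[OF F(1)] unfolding drawing_def by blast
    ultimately have "- (pos ` V) \<subseteq> F"
      using fr faceD(3)[OF F(1)] by (intro connected_subset_of_frontier_disjoint) blast+
    then have "edge_image a b \<subseteq> pos ` V"
      using faceD(4)[OF F(1)] edge_subset_drawing[OF assms] by blast
    moreover obtain q where q: "q \<in> edge_interior a b" using edge_interior_props(1)[OF assms] by blast
    ultimately obtain w where "w \<in> V" "q = pos w" by blast
    then show False using vertex_on_edge[OF assms] q by auto
  qed
  then obtain q where q: "q \<in> frontier F" "q \<notin> pos ` V" by blast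
  then obtain u v where uv: "adj u v" "q \<in> edge_image u v"
    using frD unfolding drawing_def by blast
  then have "q \<in> edge_interior u v" using q(2) adjD[OF uv(1)] by blast
  moreover have "q \<in> closure F" using q(1) by (simp add: frontier_def)
  ultimately show thesis using that uv(1) F by blast
qed

end

section \<open>Near-triangulations\<close>

lemma sum_card_Collect_commute:
  assumes "finite A" "finite B"
  shows "(\<Sum>x\<in>A. card {y \<in> B. R x y}) = (\<Sum>y\<in>B. card {x \<in> A. R x y})"
proof -
  have "(\<Sum>x\<in>A. card {y \<in> B. R x y}) = (\<Sum>x\<in>A. \<Sum>y\<in>B. if R x y then 1 else 0)"
    using assms by (intro sum.cong) (simp_all add: sum.If_cases Int_def)
  also have "\<dots> = (\<Sum>y\<in>B. \<Sum>x\<in>A. if R x y then 1 else 0)" by (rule sum.swap)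
  also have "\<dots> = (\<Sum>y\<in>B. card {x \<in> A. R x y})"
    using assms by (intro sum.cong) (simp_all add: sum.If_cases Int_def)
  finally show ?thesis .
qed

text \<open>Counting the edges from both classes gives \<open>2 * card X = 2 * card Y\<close> for
  the classes \<open>X\<close> and \<open>Y\<close>.\<close>

lemma two_regular_bipartite_even:
  fixes f :: "'a \<Rightarrow> bool"
  assumes N: "finite N" and H: "\<And>x y. H x y \<Longrightarrow> x \<in> N \<and> y \<in> N \<and> H y x"
    and reg: "\<And>x. x \<in> N \<Longrightarrow> card {y. H x y} = 2"
    and f: "\<And>x y. H x y \<Longrightarrow> f x \<noteq> f y"
  shows "even (card N)"
proof -
  let ?X = "{x \<in> N. f x}" and ?Y = "{x \<in> N. \<not> f x}"
  have "(\<Sum>x\<in>?X. card {y \<in> ?Y. H x y}) = (\<Sum>x\<in>?X. 2)"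
  proof (rule sum.cong)
    fix x assume x: "x \<in> ?X"
    then have "{y \<in> ?Y. H x y} = {y. H x y}" using H f by blast
    then show "card {y \<in> ?Y. H x y} = 2" using reg x by simp
  qed simp
  moreover have "(\<Sum>y\<in>?Y. card {x \<in> ?X. H x y}) = (\<Sum>y\<in>?Y. 2)"
  proof (rule sum.cong)
    fix y assume y: "y \<in> ?Y"
    then have "{x \<in> ?X. H x y} = {x. H y x}" using H f by blast
    then show "card {x \<in> ?X. H x y} = 2" using reg y by simp
  qed simp
  ultimately have "card ?X = card ?Y"
    using sum_card_Collect_commute[of ?X ?Y H] N by simp
  moreover have "card N = card ?X + card ?Y"
  proof -
    have "N = ?X \<union> ?Y" by blast
    moreover have "card (?X \<union> ?Y) = card ?X + card ?Y" by (rule card_Un_disjoint) (use N in auto)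
    ultimately show ?thesis by simp
  qed
  ultimately show ?thesis by simp
qed

text \<open>Each of \<open>u\<close> and \<open>v\<close> sends only one edge to the other class, so
  the count becomes \<open>2 * card X - 2 = 2 * card Y\<close>, and \<open>N\<close> has
  \<open>2 * card X - 1\<close> elements.\<close>

lemma two_regular_almost_bipartite_odd:
  fixes f :: "'a \<Rightarrow> bool"
  assumes N: "finite N" and H: "\<And>x y. H x y \<Longrightarrow> x \<in> N \<and> y \<in> N \<and> H y x"
    and reg: "\<And>x. x \<in> N \<Longrightarrow> card {y. H x y} = 2"
    and uv: "H u v" "u \<noteq> v" "f u" "f v"
    and f: "\<And>x y. H x y \<Longrightarrow> {x, y} \<noteq> {u, v} \<Longrightarrow> f x \<noteq> f y"
  shows "odd (card N)"
proof -
  let ?X = "{x \<in> N. f x}" and ?Y = "{x \<in> N. \<not> f x}"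
  have uvX: "u \<in> ?X" "v \<in> ?X" using H[OF uv(1)] uv by auto
  have u1: "card {y \<in> ?Y. H u y} = 1"
  proof -
    have "{y \<in> ?Y. H u y} = {y. H u y} - {v}"
      using uv H f by (auto simp: doubleton_eq_iff)
    then show ?thesis using reg[of u] uv uvX by simp
  qed
  have v1: "card {y \<in> ?Y. H v y} = 1"
  proof -
    have "{y \<in> ?Y. H v y} = {y. H v y} - {u}"
      using uv H f by (auto simp: doubleton_eq_iff)
    then show ?thesis using reg[of v] uv uvX H by simp
  qed
  have rest: "card {y \<in> ?Y. H x y} = 2" if "x \<in> ?X - {u, v}" for x
  proof -
    have "{y \<in> ?Y. H x y} = {y. H x y}"
      using that H f[of x] by (auto simp: doubleton_eq_iff)
    then show ?thesis using reg that by simp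
  qed
  have "(\<Sum>x\<in>?X. card {y \<in> ?Y. H x y}) =
      (\<Sum>x\<in>?X - {u, v}. card {y \<in> ?Y. H x y}) + (\<Sum>x\<in>{u, v}. card {y \<in> ?Y. H x y})"
    using N uvX by (intro sum.subset_diff) auto
  also have "\<dots> = 2 * card (?X - {u, v}) + 2"
    using u1 v1 \<open>u \<noteq> v\<close> rest by simp
  also have "(\<Sum>x\<in>?X. card {y \<in> ?Y. H x y}) = (\<Sum>y\<in>?Y. card {x \<in> ?X. H x y})"
    by (rule sum_card_Collect_commute) (use N in auto)
  also have "\<dots> = (\<Sum>y\<in>?Y. 2)"
  proof (rule sum.cong)
    fix y assume y: "y \<in> ?Y"
    then have "{x \<in> ?X. H x y} = {x. H y x}" using H f[of y] uv by (auto simp: doubleton_eq_iff)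
    then show "card {x \<in> ?X. H x y} = 2" using reg y by simp
  qed simp
  finally have "card ?Y = card (?X - {u, v}) + 1" by simp
  moreover have "card (?X - {u, v}) + 2 = card ?X"
  proof -
    have "card (?X - {u, v}) = card ?X - card {u, v}" by (rule card_Diff_subset) (use uvX in auto)
    moreover have "card {u, v} \<le> card ?X" by (rule card_mono) (use uvX N in auto)
    ultimately show ?thesis using \<open>u \<noteq> v\<close> by simp
  qed
  moreover have "card N = card ?X + card ?Y"
  proof -
    have "N = ?X \<union> ?Y" by blast
    moreover have "card (?X \<union> ?Y) = card ?X + card ?Y" by (rule card_Un_disjoint) (use N in auto)
    ultimately show ?thesis by simp
  qed
  ultimately show ?thesis by presburger
qed

section \<open>Triangular faces around a vertex\<close>

locale near_triangulated = plane_graph +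
  assumes bounded_face_triangle: "\<And>F. F \<in> faces V adj pos cv \<Longrightarrow> bounded F \<Longrightarrow>
    \<exists>a\<in>V. \<exists>b\<in>V. \<exists>c\<in>V. distinct [a, b, c] \<and> adj a b \<and> adj b c \<and> adj c a
      \<and> frontier F = path_image (cv a b) \<union> path_image (cv b c) \<union> path_image (cv c a)"
begin

text \<open>An interior point of \<open>u v\<close> lies on no other edge, so the side of the
  triangle that contains it is \<open>u v\<close>; the rest is rotation and reflection of the corner
  names.\<close>

lemma triangle_at_edge:
  assumes F: "face F" "bounded F" and "adj u v" and q: "q \<in> edge_interior u v" "q \<in> closure F"
  obtains w where "adj u w" "adj v w"
    "frontier F = edge_image u v \<union> edge_image u w \<union> edge_image v w"
proof -
  obtain a b c where abc: "adj a b" "adj b c" "adj c a"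
    "frontier F = edge_image a b \<union> edge_image b c \<union> edge_image c a"
    using bounded_face_triangle[OF F] by blast
  have "q \<in> frontier F"
    using face_frontier[OF F(1) q(2)] q(1) edge_subset_drawing[OF \<open>adj u v\<close>] by blast
  then consider "q \<in> edge_image a b" | "q \<in> edge_image b c" | "q \<in> edge_image c a"
    using abc(4) by blast
  then obtain x y w where xyw: "adj x y" "adj y w" "adj w x" "q \<in> edge_image x y"
    "frontier F = edge_image x y \<union> edge_image y w \<union> edge_image w x"
  proof cases
    case 1 then show thesis using that[of a b c] abc by blast
  next
    case 2 then show thesis using that[of b c a] abc by blast
  next
    case 3 then show thesis using that[of c a b] abc by blast
  qed
  have "{x, y} = {u, v}" using edge_interior_unique[OF \<open>adj u v\<close> xyw(1) q(1) xyw(4)] .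
  then consider "x = u" "y = v" | "x = v" "y = u" by (auto simp: doubleton_eq_iff)
  then show thesis
  proof cases
    case 1
    then show thesis
      using that[of w] xyw adjD(4)[OF xyw(3)] edgeD(4)[OF xyw(3)] by (simp add: Un_ac)
  next
    case 2
    then show thesis
      using that[of w] xyw adjD(4)[OF xyw(3)] edgeD(4)[OF xyw(3)] edgeD(4)[OF xyw(1)] by (simp add: Un_ac)
  qed
qed

text \<open>Some bounded face touches the interior of the edge, and the other two sides of its
  triangle form a detour from \<open>v\<close> to \<open>u\<close>.\<close>

lemma inner_edge_not_bridge:
  assumes inner: "inner_vertex V adj pos cv v" and "adj v u"
  shows "(del_edge adj v u)\<^sup>*\<^sup>* v u"
proof -
  interpret D: plane_graph V "del_edge adj v u" pos cv by (rule del_edge_subgraph)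
  obtain F where F: "F \<in> faces V (del_edge adj v u) pos cv" "edge_interior v u \<subseteq> F"
    "faces V adj pos cv = (faces V (del_edge adj v u) pos cv - {F}) \<union> components (F - edge_image v u)"
    using deleted_face[OF \<open>adj v u\<close>] .
  note F_open = D.faceD(1)[OF F(1)] and F_conn = D.faceD(2)[OF F(1)]
  \<comment> \<open>The arc has empty interior, so cutting it out of \<open>F\<close> leaves points
    arbitrarily close to it.\<close>
  have dense: "edge_image v u \<subseteq> closure (F - edge_image v u)"
  proof -
    have "interior (edge_image v u) = {}" using interior_arc_image_empty edgeD(1)[OF \<open>adj v u\<close>] by blast
    then have "closure (- edge_image v u) = UNIV" by (simp add: closure_interior)
    then have "F \<subseteq> closure (F \<inter> - edge_image v u)"
      using open_Int_closure_subset[OF F_open, of "- edge_image v u"] by simp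
    then have "edge_interior v u \<subseteq> closure (F - edge_image v u)" using F(2) by (simp add: Diff_eq)
    then show ?thesis
      using edge_interior_props(3)[OF \<open>adj v u\<close>] closure_minimal[OF _ closed_closure] by (meson order_trans)
  qed
  have "\<exists>C. C \<in> components (F - edge_image v u) \<and> bounded C"
  proof (rule ccontr)
    assume unb: "\<not> ?thesis"
    \<comment> \<open>If all pieces of \<open>F\<close> were unbounded, there would be just one, by
      uniqueness of the unbounded face. It would have \<open>pos v\<close> on its frontier, although
      \<open>v\<close> is inner.\<close>
    have ne: "F - edge_image v u \<noteq> {}"
    proof
      assume "F - edge_image v u = {}"
      then have "edge_image v u \<subseteq> closure {}" using dense by (simp only:)
      then show False using ends_on_edge[OF \<open>adj v u\<close>] by simp
    qed
    then obtain C where C: "C \<in> components (F - edge_image v u)"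
      using components_eq_empty by blast
    have "D = C" if "D \<in> components (F - edge_image v u)" for D
      using unb C that F(3) unbounded_face_unique[of D C] by blast
    then have "components (F - edge_image v u) = {C}" using C by blast
    then have "F - edge_image v u = C" using Union_components[of "F - edge_image v u"] by simp
    then have "pos v \<in> closure C" using dense ends_on_edge[OF \<open>adj v u\<close>] by blast
    moreover have "face C" "\<not> bounded C" using C F(3) unb by blast+
    moreover have "pos v \<in> drawing V adj pos cv" using vertex_in_drawing adjD(1)[OF \<open>adj v u\<close>] .
    ultimately show False
      using face_frontier[of C "pos v"] inner unfolding inner_vertex_def by blast
  qed
  then obtain C where C: "C \<in> components (F - edge_image v u)" "bounded C" by blast
  have "face C" using C(1) F(3) by blast
  \<comment> \<open>A piece staying away from the edge would have no frontier point in
    \<open>F\<close>, hence be all of the connected set \<open>F\<close>, which contains the edge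
    interior.\<close>
  have "edge_interior v u \<inter> closure C \<noteq> {}"
  proof (rule ccontr)
    assume no: "\<not> ?thesis"
    have CF: "C \<subseteq> F - edge_image v u" using in_components_subset[OF C(1)] .
    have "F \<inter> frontier C = {}"
    proof (rule ccontr)
      assume "F \<inter> frontier C \<noteq> {}"
      then obtain p where p: "p \<in> F" "p \<in> frontier C" by blast
      have "p \<notin> C" using p(2) faceD(1)[OF \<open>face C\<close>] by (simp add: frontier_def interior_open)
      have pc: "p \<in> closure C" using p(2) by (simp add: frontier_def)
      have "p \<notin> edge_image v u"
        using no pc p(1) D.faceD(4)[OF F(1)] edge_Int_drawing_del_edge[OF \<open>adj v u\<close>] by blast
      then have "p \<in> (F - edge_image v u) \<inter> closure C" using p(1) pc by blast
      moreover obtain T where T: "closed T" "C = (F - edge_image v u) \<inter> T"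
        using closedin_component[OF C(1)] unfolding closedin_closed by blast
      moreover have "closure C \<subseteq> T" using T by (intro closure_minimal) auto
      ultimately show False using \<open>p \<notin> C\<close> by blast
    qed
    then have "F \<subseteq> C"
      using CF in_components_nonempty[OF C(1)] by (intro connected_subset_of_frontier_disjoint[OF F_conn]) auto
    then show False using CF F(2) edge_interior_props(1)[OF \<open>adj v u\<close>] by blast
  qed
  then obtain q where q: "q \<in> edge_interior v u" "q \<in> closure C" by blast
  obtain w where w: "adj v w" "adj u w"
    using triangle_at_edge[OF \<open>face C\<close> C(2) \<open>adj v u\<close> q] .
  then have "del_edge adj v u v w" "del_edge adj v u w u"
    using adjD[OF w(1)] adjD[OF w(2)] unfolding del_edge_def by (auto simp: doubleton_eq_iff)
  then show ?thesis by (meson converse_rtranclp_into_rtranclp r_into_rtranclp)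
qed

text \<open>For fixed inner \<open>v\<close>, this is the 2-regular graph on the neighbours of
  \<open>v\<close> formed by the edges opposite to \<open>v\<close>.\<close>

definition facial :: "'a \<Rightarrow> 'a \<Rightarrow> 'a \<Rightarrow> bool" where
  "facial v u w \<longleftrightarrow> adj v u \<and> adj v w \<and> adj u w \<and>
     (\<exists>F. face F \<and> bounded F \<and> frontier F = edge_image v u \<union> edge_image v w \<union> edge_image u w)"

lemma facial_commute: "facial v u w \<longleftrightarrow> facial v w u"
proof -
  have "facial v w u" if "facial v u w" for u w
    using that adjD(4)[of u w] edgeD(4)[of u w] unfolding facial_def by (auto simp: Un_ac)
  then show ?thesis by blast
qed

lemma triangle_third_vertex_unique:
  assumes "adj v u" "adj v w" "adj u w" "adj v w'" "adj u w'"
    and eq: "edge_image v u \<union> edge_image v w \<union> edge_image u w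
      = edge_image v u \<union> edge_image v w' \<union> edge_image u w'"
  shows "w = w'"
proof -
  have "pos w \<in> edge_image v u \<union> edge_image v w' \<union> edge_image u w'"
    using ends_on_edge[OF assms(2)] eq by blast
  then show ?thesis
    using vertex_on_edge[OF assms(1), of w] vertex_on_edge[OF assms(4), of w] vertex_on_edge[OF assms(5), of w]
      adjD[OF assms(2)] adjD[OF assms(3)] by blast
qed

text \<open>As \<open>v u\<close> is no bridge, exactly two faces lie along it. Both reach
  \<open>v\<close>, so they are bounded and thus triangles; a common third vertex would make them
  the same face.\<close>

lemma card_facial:
  assumes inner: "inner_vertex V adj pos cv v" and "adj v u"
  shows "card {w. facial v u w} = 2"
proof -
  obtain A B where AB: "A \<noteq> B" "face A" "face B" "edge_image v u \<subseteq> closure A" "edge_image v u \<subseteq> closure B"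
    "closure A \<inter> closure B \<subseteq> edge_image v u \<union> \<Union> {edge_image x y | x y. del_edge adj v u x y}"
    and only: "\<forall>C q. face C \<longrightarrow> q \<in> closure C \<longrightarrow> q \<in> edge_interior v u \<longrightarrow> C = A \<or> C = B"
    using two_faces[OF \<open>adj v u\<close> order_refl inner_edge_not_bridge[OF assms]] .
  obtain q where q: "q \<in> edge_interior v u" using edge_interior_props(1)[OF \<open>adj v u\<close>] by blast
  have bd: "bounded C" if C: "face C" "edge_image v u \<subseteq> closure C" for C
  proof -
    have "pos v \<in> frontier C"
      using face_frontier[OF C(1)] C(2) ends_on_edge[OF \<open>adj v u\<close>] vertex_in_drawing adjD(1)[OF \<open>adj v u\<close>] by blast
    then show ?thesis using inner C(1) unfolding inner_vertex_def by blast
  qed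
  have bA: "bounded A" and bB: "bounded B" using bd AB by blast+
  have qA: "q \<in> closure A" and qB: "q \<in> closure B" using q AB by blast+
  obtain a where a: "adj v a" "adj u a" "frontier A = edge_image v u \<union> edge_image v a \<union> edge_image u a"
    using triangle_at_edge[OF AB(2) bA \<open>adj v u\<close> q qA] .
  obtain b where b: "adj v b" "adj u b" "frontier B = edge_image v u \<union> edge_image v b \<union> edge_image u b"
    using triangle_at_edge[OF AB(3) bB \<open>adj v u\<close> q qB] .
  have "a \<noteq> b"
  proof
    assume "a = b"
    then have "A = B"
      using triangle_frontier_unique[OF AB(2) bA AB(3) bB \<open>adj v u\<close> a] b(3) a(3) by simp
    with AB(1) show False ..
  qed
  moreover have "{w. facial v u w} = {a, b}"
  proof (intro equalityI subsetI)
    fix w assume "w \<in> {w. facial v u w}"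
    then obtain C where w: "adj v w" "adj u w" and C: "face C"
      "frontier C = edge_image v u \<union> edge_image v w \<union> edge_image u w"
      unfolding facial_def by blast
    have "q \<in> closure C" using C(2) q by (auto simp: frontier_def)
    then have "frontier C = frontier A \<or> frontier C = frontier B" using only C(1) q by blast
    then show "w \<in> {a, b}"
      using triangle_third_vertex_unique[OF \<open>adj v u\<close> w] a b C(2) by auto
  next
    fix w assume "w \<in> {a, b}"
    then show "w \<in> {w. facial v u w}"
      using AB(2,3) bA bB a b \<open>adj v u\<close> unfolding facial_def by auto
  qed
  ultimately show ?thesis by simp
qed

end

section \<open>Colouring\<close>

lemma near_triangulated_iff:
  "near_triangulation V adj pos cv \<longleftrightarrow> near_triangulated V adj pos cv"
  unfolding near_triangulation_def near_triangulated_def near_triangulated_axioms_def plane_graph_def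
  by blast

text \<open>\<open>K\<close> will be a component of the graph, or a component of the graph without a vertex \<open>w\<close> of
  colour \<open>k\<close>; the two colours swapped on \<open>K\<close> are then both different from \<open>k\<close>.\<close>
lemma recolour:
  fixes c :: "'v \<Rightarrow> nat"
  assumes sym: "\<And>x y. adj x y \<Longrightarrow> adj y x" and range: "\<And>x. c x < 3"
    and proper: "\<And>x y. adj x y \<Longrightarrow> c x \<noteq> c y"
    and K: "\<And>x y. adj x y \<Longrightarrow> x \<in> K \<Longrightarrow> y \<in> K \<or> c y = k"
    and uv: "u \<in> K" "v \<notin> K" "c u \<noteq> k" "c u = c v"
  obtains c' :: "'v \<Rightarrow> nat" where "\<And>x. c' x < 3" "\<And>x y. adj x y \<Longrightarrow> c' x \<noteq> c' y" "c' u \<noteq> c' v"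
proof -
  \<comment> \<open>One of the three colours differs from both \<open>c u\<close> and
    \<open>k\<close>.\<close>
  obtain m where m: "m < 3" "m \<noteq> c u" "m \<noteq> k"
  proof -
    have "card {c u, k} < card {..<3::nat}" by (simp add: card_insert_if)
    then have "\<not> {..<3} \<subseteq> {c u, k}" by (metis card_mono finite.emptyI finite_insert linorder_not_less)
    then show thesis using that by blast
  qed
  define \<pi> where "\<pi> = Transposition.transpose (c u) m"
  have \<pi>: "\<pi> k = k" "\<pi> a = \<pi> b \<longleftrightarrow> a = b" "\<pi> (c u) = m" for a b
    using uv(3) m by (auto simp: \<pi>_def Transposition.transpose_def)
  have \<pi>3: "\<pi> a < 3" if "a < 3" for a using that m range[of u] by (simp add: \<pi>_def Transposition.transpose_def)
  define c' where "c' x = (if x \<in> K then \<pi> (c x) else c x)" for x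
  \<comment> \<open>An edge leaving \<open>K\<close> ends in colour \<open>k\<close>, which
    \<open>\<pi>\<close> fixes, so \<open>\<pi>\<close> acts on both ends and injectivity keeps them
    different.\<close>
  have step: "c' x \<noteq> c' y" if "adj x y" "x \<in> K" for x y
  proof (cases "y \<in> K")
    case True then show ?thesis using that proper \<pi>(2) by (simp add: c'_def)
  next
    case False
    then have "c y = k" using K that by blast
    then have "c' y = \<pi> (c y)" using False \<pi>(1) by (simp add: c'_def)
    then show ?thesis using that proper[OF that(1)] \<pi>(2) by (simp add: c'_def)
  qed
  show thesis
  proof
    show "c' x < 3" for x using range[of x] \<pi>3 by (simp add: c'_def)
    show "c' x \<noteq> c' y" if "adj x y" for x y
    proof (cases "x \<in> K \<or> y \<in> K")
      case True then show ?thesis using step[of x y] step[of y x] sym that by fastforce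
    next
      case False then show ?thesis using proper[OF that] by (simp add: c'_def)
    qed
    show "c' u \<noteq> c' v" using uv m(2) \<pi>(3) by (simp add: c'_def)
  qed
qed

section \<open>From internal evenness to a 3-colouring\<close>

context near_triangulated
begin

lemma even_degree_of_bipartite_neighbourhood:
  assumes inner: "inner_vertex V adj pos cv v"
    and f: "\<And>x y. adj v x \<Longrightarrow> adj v y \<Longrightarrow> adj x y \<Longrightarrow> f x \<noteq> (f y :: bool)"
  shows "even (degree V adj v)"
  unfolding degree_def
proof (rule two_regular_bipartite_even[where H = "facial v" and f = f])
  show "finite {u \<in> V. adj v u}" using finite_V by simp
  show "x \<in> {u \<in> V. adj v u} \<and> y \<in> {u \<in> V. adj v u} \<and> facial v y x" if "facial v x y" for x y
    using that facial_commute[of v x y] adjD(2)[of v] by (auto simp: facial_def)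
  show "card {y. facial v x y} = 2" if "x \<in> {u \<in> V. adj v u}" for x
    using card_facial[OF inner] that by blast
  show "f x \<noteq> f y" if "facial v x y" for x y
    using that f unfolding facial_def by blast
qed

text \<open>The edges at \<open>w\<close> are properly coloured, so its neighbours use only two
  colours. If \<open>u\<close> and \<open>v\<close> agreed, having the colour of \<open>u\<close>
  would be a 2-colouring of \<open>facial w\<close> that fails on \<open>u v\<close> alone, and the
  degree of \<open>w\<close> would be odd.\<close>

lemma inner_vertex_opposite_colours:
  fixes c :: "'a \<Rightarrow> nat"
  assumes inner: "inner_vertex V adj pos cv w" and ev: "even (degree V adj w)"
    and range: "\<And>x. c x < 3" and proper: "\<And>x y. del_edge adj u v x y \<Longrightarrow> c x \<noteq> c y"
    and uv: "facial w u v"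
  shows "c u \<noteq> c v"
proof
  assume eq: "c u = c v"
  have tri: "adj w u" "adj w v" "adj u v" using uv unfolding facial_def by blast+
  have ne: "u \<noteq> v" "w \<noteq> u" "w \<noteq> v" using adjD(3) tri by blast+
  have w_col: "c x \<noteq> c w" if "adj w x" for x
    using proper[of w x] that ne unfolding del_edge_def by (auto simp: doubleton_eq_iff)
  have "odd (card {u \<in> V. adj w u})"
  proof (rule two_regular_almost_bipartite_odd[where H = "facial w" and f = "\<lambda>x. c x = c u" and u = u and v = v])
    show "finite {u \<in> V. adj w u}" using finite_V by simp
    show "x \<in> {u \<in> V. adj w u} \<and> y \<in> {u \<in> V. adj w u} \<and> facial w y x" if "facial w x y" for x y
      using that facial_commute[of w x y] adjD(2)[of w] by (auto simp: facial_def)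
    show "card {y. facial w x y} = 2" if "x \<in> {u \<in> V. adj w u}" for x
      using card_facial[OF inner] that by blast
    show "facial w u v" "u \<noteq> v" "c u = c u" "c v = c u" using uv ne eq by simp_all
    show "(c x = c u) \<noteq> (c y = c u)" if xy: "facial w x y" "{x, y} \<noteq> {u, v}" for x y
    proof -
      have "adj w x" "adj w y" "del_edge adj u v x y"
        using xy unfolding facial_def del_edge_def by blast+
      then have "c x \<noteq> c w" "c y \<noteq> c w" "c x \<noteq> c y" "c u \<noteq> c w"
        using w_col proper tri by blast+
      then show ?thesis using range[of x] range[of y] range[of u] range[of w] by linarith
    qed
  qed
  then show False using ev unfolding degree_def by simp
qed

lemma three_colourable_step:
  fixes c :: "'a \<Rightarrow> nat"
  assumes even_inner: "internally_even V adj pos cv"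
    and e: "adj u v" "q \<in> edge_interior u v" and outer_face: "face R" "\<not> bounded R" "q \<in> closure R"
    and range: "\<And>x. c x < 3" and proper: "\<And>x y. del_edge adj u v x y \<Longrightarrow> c x \<noteq> c y"
  obtains c' :: "'a \<Rightarrow> nat" where "\<And>x. c' x < 3" "\<And>x y. adj x y \<Longrightarrow> c' x \<noteq> c' y"
proof -
  interpret D: plane_graph V "del_edge adj u v" pos cv by (rule del_edge_subgraph)
  let ?adj = "del_edge adj u v"
  note result = that
  \<comment> \<open>It suffices to colour the graph without \<open>u v\<close> properly so that
    \<open>u\<close> and \<open>v\<close> receive different colours.\<close>
  have finish: thesis if c': "\<And>x. c' x < 3" "\<And>x y. ?adj x y \<Longrightarrow> c' x \<noteq> c' y" "c' u \<noteq> c' v"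
    for c' :: "'a \<Rightarrow> nat"
  proof (rule result[of c'])
    show "c' x < 3" for x by (rule c')
    show "c' x \<noteq> c' y" if "adj x y" for x y
    proof (cases "{x, y} = {u, v}")
      case True then show ?thesis using c'(3) by (auto simp: doubleton_eq_iff)
    next
      case False then show ?thesis using c'(2)[of x y] that by (simp add: del_edge_def)
    qed
  qed
  show thesis
  proof (cases "c u = c v")
    case False then show ?thesis using finish[of c] range proper by blast
  next
    case eq: True
    show ?thesis
    proof (cases "?adj\<^sup>*\<^sup>* u v")
      case False
      \<comment> \<open>No edge leaves the component of \<open>u\<close>, so \<open>k\<close> can be
        any number other than \<open>c u\<close>.\<close>
      obtain k where k: "k \<noteq> c u" by (metis n_not_Suc_n)
      show ?thesis
      proof (rule recolour[where adj = ?adj and c = c and K = "{x. ?adj\<^sup>*\<^sup>* u x}" and k = k and u = u and v = v])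
        show "?adj y x" if "?adj x y" for x y by (rule D.adjD(4)[OF that])
        show "c x < 3" for x by (rule range)
        show "c x \<noteq> c y" if "?adj x y" for x y by (rule proper[OF that])
        show "y \<in> {x. ?adj\<^sup>*\<^sup>* u x} \<or> c y = k" if "?adj x y" "x \<in> {x. ?adj\<^sup>*\<^sup>* u x}" for x y
          using that by (auto intro: rtranclp.rtrancl_into_rtrancl)
        show "u \<in> {x. ?adj\<^sup>*\<^sup>* u x}" "v \<notin> {x. ?adj\<^sup>*\<^sup>* u x}" "c u \<noteq> k" "c u = c v"
          using False eq k by auto
      qed (rule finish)
    next
      case True
      obtain A B where AB: "A \<noteq> B" "face A" "face B" "edge_image u v \<subseteq> closure A" "edge_image u v \<subseteq> closure B"
        "closure A \<inter> closure B \<subseteq> edge_image u v \<union> \<Union> {edge_image x y | x y. ?adj x y}"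
        and AB_only: "\<forall>C q. face C \<longrightarrow> q \<in> closure C \<longrightarrow> q \<in> edge_interior u v \<longrightarrow> C = A \<or> C = B"
        using two_faces[OF e(1) order_refl True] .
      have "q \<in> closure A" "q \<in> closure B" using AB(4,5) e(2) by auto
      moreover have "R = A \<or> R = B" using AB_only[rule_format, OF outer_face(1,3) e(2)] .
      \<comment> \<open>\<open>T\<close> is the face across the edge from the outer face
        \<open>R\<close>.\<close>
      ultimately obtain T where T: "T \<noteq> R" "face T" "q \<in> closure T"
        using AB(1-3) by metis
      have "bounded T" using unbounded_face_unique[OF T(2) _ outer_face(1,2)] T(1) by blast
      obtain w where w: "adj u w" "adj v w" "frontier T = edge_image u v \<union> edge_image u w \<union> edge_image v w"
        using triangle_at_edge[OF T(2) \<open>bounded T\<close> e T(3)] .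
      have ne: "u \<noteq> v" "u \<noteq> w" "v \<noteq> w" using adjD(3) e(1) w by blast+
      have wV: "w \<in> V" using adjD(2)[OF w(1)] .
      show ?thesis
      proof (cases "inner_vertex V adj pos cv w")
        case inner: True
        have "frontier T = edge_image w u \<union> edge_image w v \<union> edge_image u v"
          using w edgeD(4)[OF w(1)] edgeD(4)[OF w(2)] by auto
        then have "facial w u v"
          using T(2) \<open>bounded T\<close> e(1) adjD(4)[OF w(1)] adjD(4)[OF w(2)] unfolding facial_def by blast
        moreover have "even (degree V adj w)"
          using even_inner inner unfolding internally_even_def by blast
        ultimately have "c u \<noteq> c v"
          using inner_vertex_opposite_colours[of w c u v] inner range proper by blast
        then show ?thesis using eq by blast
      next
        case outer: False
        then obtain F where "face F" "\<not> bounded F" "pos w \<in> frontier F"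
          using wV unfolding inner_vertex_def by blast
        then have wR: "pos w \<in> closure R"
          using unbounded_face_unique[OF _ _ outer_face(1,2)] by (auto simp: frontier_def)
        have wT: "pos w \<in> closure T"
          using w(3) ends_on_edge[OF w(1)] by (auto simp: frontier_def)
        define adj2 where "adj2 x y \<longleftrightarrow> ?adj x y \<and> x \<noteq> w \<and> y \<noteq> w" for x y
        \<comment> \<open>\<open>w\<close> is in the closures of both \<open>T\<close> and
          \<open>R\<close>. Given a walk avoiding \<open>w\<close>, these closures would meet only
          on \<open>u v\<close> and on edges not ending in \<open>w\<close>.\<close>
        have no: "\<not> adj2\<^sup>*\<^sup>* u v"
        proof
          assume walk: "adj2\<^sup>*\<^sup>* u v"
          have le: "adj2 \<le> ?adj" by (auto simp: adj2_def)
          obtain A B where AB: "A \<noteq> B" "face A" "face B" "edge_image u v \<subseteq> closure A" "edge_image u v \<subseteq> closure B"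
            "closure A \<inter> closure B \<subseteq> edge_image u v \<union> \<Union> {edge_image x y | x y. adj2 x y}"
            and AB_only: "\<forall>C q. face C \<longrightarrow> q \<in> closure C \<longrightarrow> q \<in> edge_interior u v \<longrightarrow> C = A \<or> C = B"
            using two_faces[OF e(1) le walk] .
          have "T = A \<or> T = B" "R = A \<or> R = B"
            using AB_only[rule_format, OF T(2,3) e(2)] AB_only[rule_format, OF outer_face(1,3) e(2)] by simp_all
          then have "pos w \<in> closure A \<inter> closure B" using T(1) wR wT by blast
          then consider "pos w \<in> edge_image u v" | x y where "adj2 x y" "pos w \<in> edge_image x y"
            using AB(6) by blast
          then show False
          proof cases
            case 1 then show False using vertex_on_edge[OF e(1) wV] ne by blast
          next
            case 2 then show False using vertex_on_edge[of x y w] wV unfolding adj2_def del_edge_def by blast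
          qed
        qed
        have "?adj u w" using w(1) ne by (auto simp: del_edge_def doubleton_eq_iff)
        show ?thesis
        \<comment> \<open>Edges leaving this set can only end in \<open>w\<close>, so the colour to
          be fixed is \<open>c w\<close>; it differs from \<open>c u\<close> because
          \<open>u w\<close> is still an edge.\<close>
        proof (rule recolour[where adj = ?adj and c = c and K = "{x. adj2\<^sup>*\<^sup>* u x}" and k = "c w" and u = u and v = v])
          show "?adj y x" if "?adj x y" for x y by (rule D.adjD(4)[OF that])
          show "c x < 3" for x by (rule range)
          show "c x \<noteq> c y" if "?adj x y" for x y by (rule proper[OF that])
          have avoid: "x \<noteq> w" if "adj2\<^sup>*\<^sup>* u x" for x
            using that by cases (use ne in \<open>auto simp: adj2_def\<close>)
          show "y \<in> {x. adj2\<^sup>*\<^sup>* u x} \<or> c y = c w" if "?adj x y" "x \<in> {x. adj2\<^sup>*\<^sup>* u x}" for x y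
          proof (cases "y = w")
            case False
            then have "adj2 x y" using that avoid[of x] by (simp add: adj2_def)
            then have "adj2\<^sup>*\<^sup>* u y" using that(2) by (simp add: rtranclp.rtrancl_into_rtrancl)
            then show ?thesis by simp
          qed simp
          show "u \<in> {x. adj2\<^sup>*\<^sup>* u x}" "v \<notin> {x. adj2\<^sup>*\<^sup>* u x}" "c u \<noteq> c w" "c u = c v"
            using no eq proper[OF \<open>?adj u w\<close>] by auto
        qed (rule finish)
      qed
    qed
  qed
qed

text \<open>Deletion only enlarges the outer face, so the remaining bounded faces are old triangles.
  A vertex that is inner afterwards was inner before and is not an end of \<open>u v\<close>, so its
  degree is unchanged.\<close>

lemma del_outer_edge:
  assumes e: "adj u v" "q \<in> edge_interior u v" and outer_face: "face R" "\<not> bounded R" "q \<in> closure R"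
  shows "near_triangulated V (del_edge adj u v) pos cv"
    and "internally_even V adj pos cv \<Longrightarrow> internally_even V (del_edge adj u v) pos cv"
proof -
  let ?adj = "del_edge adj u v"
  interpret D: plane_graph V ?adj pos cv by (rule del_edge_subgraph)
  obtain F where F: "F \<in> faces V ?adj pos cv" "edge_interior u v \<subseteq> F"
    "faces V adj pos cv = (faces V ?adj pos cv - {F}) \<union> components (F - edge_image u v)"
    using deleted_face[OF e(1)] .
  have "R \<in> components (F - edge_image u v)"
    using face_at_edge_interior[OF e(1) F outer_face(1,3) e(2)] .
  then have RF: "R \<subseteq> F" using in_components_subset by blast
  then have unbF: "\<not> bounded F" using outer_face(2) bounded_subset by blast
  show "near_triangulated V ?adj pos cv"
  proof
    fix G assume G: "G \<in> faces V ?adj pos cv" "bounded G"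
    then have GF: "G \<noteq> F" using unbF by blast
    then have "face G" using G(1) F(3) by blast
    then obtain a b c where abc: "a \<in> V" "b \<in> V" "c \<in> V" "distinct [a, b, c]" "adj a b" "adj b c" "adj c a"
      "frontier G = edge_image a b \<union> edge_image b c \<union> edge_image c a"
      using bounded_face_triangle G(2) by blast
    have "G \<inter> F = {}"
      using G(1) F(1) GF components_eq[of G "- drawing V ?adj pos cv" F] by (simp add: faces_eq_components)
    then have "F \<inter> frontier G = {}"
      using open_Int_closure_eq_empty[OF D.faceD(1)[OF F(1)], of G] by (auto simp: frontier_def)
    moreover have "\<exists>p. p \<in> F \<and> p \<in> edge_image x y" if "{x, y} = {u, v}" for x y
    proof -
      have "edge_image x y = edge_image u v"
        using that edgeD(4)[OF e(1)] by (auto simp: doubleton_eq_iff)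
      then show ?thesis using e(2) F(2) by blast
    qed
    \<comment> \<open>The deleted edge has points in \<open>F\<close>, which the frontier of
      \<open>G\<close> misses, so it is not a side of the triangle around \<open>G\<close>.\<close>
    ultimately have keep: "?adj x y" if "adj x y" "edge_image x y \<subseteq> frontier G" for x y
      using that unfolding del_edge_def by blast
    have "edge_image a b \<subseteq> frontier G" "edge_image b c \<subseteq> frontier G" "edge_image c a \<subseteq> frontier G"
      using abc(8) by auto
    then have "?adj a b" "?adj b c" "?adj c a" using abc(5-7) keep by blast+
    then show "\<exists>a\<in>V. \<exists>b\<in>V. \<exists>c\<in>V. distinct [a, b, c] \<and> ?adj a b \<and> ?adj b c \<and> ?adj c a
      \<and> frontier G = edge_image a b \<union> edge_image b c \<union> edge_image c a"
      using abc by blast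
  qed
  show "internally_even V ?adj pos cv" if ev: "internally_even V adj pos cv"
    unfolding internally_even_def
  proof (intro allI impI)
    fix x assume x: "inner_vertex V ?adj pos cv x"
    then have xV: "x \<in> V" and xF: "pos x \<notin> frontier F"
      using F(1) unbF unfolding inner_vertex_def by blast+
    have xcl: "pos x \<notin> closure F"
      using xF D.face_frontier[OF F(1)] D.vertex_in_drawing[OF xV] by blast
    have "edge_image u v \<subseteq> closure F"
      using edge_interior_props(3)[OF e(1)] closure_mono[OF F(2)] by blast
    then have ne: "x \<noteq> u" "x \<noteq> v" using xcl ends_on_edge[OF e(1)] by blast+
    have "inner_vertex V adj pos cv x"
      unfolding inner_vertex_def
    proof (intro conjI ballI impI)
      fix G assume "face G" "\<not> bounded G"
      then have "G = R" using unbounded_face_unique[OF _ _ outer_face(1,2)] by simp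
      then have "closure G \<subseteq> closure F" using closure_mono[OF RF] by blast
      then show "pos x \<notin> frontier G" using xcl by (auto simp: frontier_def)
    qed (rule xV)
    then have "even (degree V adj x)" using ev unfolding internally_even_def by blast
    moreover have "{y \<in> V. ?adj x y} = {y \<in> V. adj x y}"
      using ne by (auto simp: del_edge_def doubleton_eq_iff)
    ultimately show "even (degree V ?adj x)" unfolding degree_def by simp
  qed
qed

end

text \<open>Vertices and curves stay fixed and only \<open>adj\<close> shrinks, so the induction
  runs over the number of ordered adjacent pairs.\<close>

lemma internally_even_three_colourable:
  assumes "near_triangulated V adj pos cv" "internally_even V adj pos cv"
  shows "\<exists>c. (\<forall>x. c x < (3::nat)) \<and> (\<forall>x y. adj x y \<longrightarrow> c x \<noteq> c y)"
  using assms
proof (induction "card {(x, y). adj x y}" arbitrary: adj rule: less_induct)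
  case less
  interpret near_triangulated V adj pos cv by (rule less.prems)
  show ?case
  proof (cases "\<exists>a b. adj a b")
    case False
    then show ?thesis by (intro exI[of _ "\<lambda>_. 0"]) simp
  next
    case True
    then obtain u v q F where F: "adj u v" "q \<in> edge_interior u v" "face F" "\<not> bounded F" "q \<in> closure F"
      using outer_edge_exists by metis
    have "finite {(x, y). adj x y}"
      by (rule finite_subset[of _ "V \<times> V"]) (use adjD finite_V in auto)
    moreover have "{(x, y). del_edge adj u v x y} \<subset> {(x, y). adj x y}"
      using F(1) by (auto simp: del_edge_def)
    ultimately have "card {(x, y). del_edge adj u v x y} < card {(x, y). adj x y}"
      by (rule psubset_card_mono)
    then obtain c :: "'a \<Rightarrow> nat" where c: "\<And>x. c x < 3" "\<And>x y. del_edge adj u v x y \<Longrightarrow> c x \<noteq> c y"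
      using less.hyps[of "del_edge adj u v"] del_outer_edge[OF F] less.prems(2) by blast
    obtain c' :: "'a \<Rightarrow> nat" where "\<And>x. c' x < 3" "\<And>x y. adj x y \<Longrightarrow> c' x \<noteq> c' y"
      using three_colourable_step[OF less.prems(2) F, of c] c by blast
    then show ?thesis by blast
  qed
qed

theorem theorem4:
  fixes V :: "'v set" and adj :: "'v \<Rightarrow> 'v \<Rightarrow> bool"
    and pos :: "'v \<Rightarrow> complex" and cv :: "'v \<Rightarrow> 'v \<Rightarrow> real \<Rightarrow> complex"
  assumes "near_triangulation V adj pos cv"
    and "\<not> contains_K4 V adj"
  shows "word_representable V adj \<longleftrightarrow> internally_even V adj pos cv"
proof -
  interpret near_triangulated V adj pos cv
    using assms(1) by (simp add: near_triangulated_iff)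
  show ?thesis
  proof
    assume word: "word_representable V adj"
    show "internally_even V adj pos cv"
      unfolding internally_even_def
    proof (intro allI impI)
      fix v assume "inner_vertex V adj pos cv v"
      moreover obtain f :: "'v \<Rightarrow> bool" where "\<And>x y. adj v x \<Longrightarrow> adj v y \<Longrightarrow> adj x y \<Longrightarrow> f x \<noteq> f y"
        using neighbourhood_bipartite[OF graph word assms(2)] by blast
      ultimately show "even (degree V adj v)"
        by (rule even_degree_of_bipartite_neighbourhood)
    qed
  next
    assume "internally_even V adj pos cv"
    then obtain c :: "'v \<Rightarrow> nat" where "\<And>x. c x < 3" "\<And>x y. adj x y \<Longrightarrow> c x \<noteq> c y"
      using internally_even_three_colourable near_triangulated_axioms by blast
    then show "word_representable V adj"
      by (rule three_colourable_word_representable[OF graph])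
  qed
qed

end
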